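(* Let $n\geq 2$ and $s,t\geq 1$ be integers. Then there is no simply-connected $\pi$-finite space $X$ with rational homology of finite type such that $B\mathrm{aut}_1(X)\simeq_{\mathbb{Q}} K(\mathbb{Q}^s,n)\times K(\mathbb{Q}^t,n+1)$.
   Context: For a (CW) space $X$, $\mathrm{aut}_1(X)$ denotes the monoid of self-maps of $X$ homotopic to the identity, and $B\mathrm{aut}_1(X)$ is its classifying space; it is simply connected and classifies fibrations with fibre $X$ over simply-connected bases (it is the universal cover of $B\mathrm{aut}(X)$). The relation $\simeq_{\mathbb{Q}}$ means having the same rational homotopy type. $K(A,n)$ denotes an Eilenberg--MacLane space. Throughout, spaces are considered up to rational homotopy, and the rational homotopy type of $B\mathrm{aut}_1(X)$ is understood through Sullivan's theorem: if $(\Lambda V,d)$ is the Sullivan minimal model of $X$, then the differential graded Lie algebra $(\mathrm{Der}'(\Lambda V),D)$ is a Lie model for $B\mathrm{aut}_1(X)$. Here $\mathrm{Der}_k(\Lambda V)$ is the space of derivations of $\Lambda V$ lowering degree by $k$, the bracket is the graded commutator, $D=[d,-]$, and $\mathrm{Der}'_k(\Lambda V)=\mathrm{Der}_k(\Lambda V)$ for $k>1$, $\mathrm{Der}'_1(\Lambda V)$ is the space of $D$-cycles in $\mathrm{Der}_1(\Lambda V)$, and $\mathrm{Der}'_k(\Lambda V)=0$ for $k<1$. In particular $\pi_*(\Omega B\mathrm{aut}_1(X))\otimes\mathbb{Q}\cong H_*(\mathrm{Der}'(\Lambda V),D)$ as graded Lie algebras (Samelson product on the left). A space $X$ is called $\pi$-finite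 if it has only finitely many non-zero rational homotopy groups $\pi_i(X)\otimes\mathbb{Q}$. *)

theory Defs
  imports Complex_Main "HOL-Library.Multiset" "HOL-Library.Poly_Mapping"
    "HOL-Library.Function_Algebras" "HOL-Library.Product_Plus"
begin

section \<open>Differential graded Lie algebras over the rationals\<close>

text \<open>The sign (-1)^k applied to an element.\<close>

definition ksign :: "int \<Rightarrow> 'a::ab_group_add \<Rightarrow> 'a" where
  "ksign k x = (if even k then x else - x)"

text \<open>A graded rational vector space is a family of subspaces, one for each degree, of one
  ambient vector space.  The subspaces are not required to be independent: only homogeneous
  elements are ever used, and the bracket \<open>brk L i j\<close> and the differential \<open>dff L k\<close> carry the
  degrees of their arguments as indices.\<close>

record 'a dgl_data =
  gr :: "int \<Rightarrow> 'a set"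
  scl :: "rat \<Rightarrow> 'a \<Rightarrow> 'a"
  brk :: "int \<Rightarrow> int \<Rightarrow> 'a \<Rightarrow> 'a \<Rightarrow> 'a"
  dff :: "int \<Rightarrow> 'a \<Rightarrow> 'a"

text \<open>Reduced (that is, concentrated in degrees at least 1) differential graded Lie algebras, the
  algebraic models of simply connected spaces.\<close>

locale dgla = vector_space "scl L" for L :: "'a::ab_group_add dgl_data" +
  assumes gr_subspace: "subspace (gr L k)"
    and gr_reduced: "k < 1 \<Longrightarrow> gr L k = {0}"
    and brk_closed: "x \<in> gr L i \<Longrightarrow> y \<in> gr L j \<Longrightarrow> brk L i j x y \<in> gr L (i + j)"
    and brk_add_left: "x \<in> gr L i \<Longrightarrow> x' \<in> gr L i \<Longrightarrow> y \<in> gr L j \<Longrightarrow>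
      brk L i j (x + x') y = brk L i j x y + brk L i j x' y"
    and brk_scale_left: "x \<in> gr L i \<Longrightarrow> y \<in> gr L j \<Longrightarrow>
      brk L i j (scl L c x) y = scl L c (brk L i j x y)"
    and brk_antisym: "x \<in> gr L i \<Longrightarrow> y \<in> gr L j \<Longrightarrow>
      brk L i j x y = - ksign (i * j) (brk L j i y x)"
    and brk_jacobi: "x \<in> gr L i \<Longrightarrow> y \<in> gr L j \<Longrightarrow> z \<in> gr L k \<Longrightarrow>
      brk L i (j + k) x (brk L j k y z) =
      brk L (i + j) k (brk L i j x y) z + ksign (i * j) (brk L j (i + k) y (brk L i k x z))"
    and dff_closed: "x \<in> gr L k \<Longrightarrow> dff L k x \<in> gr L (k - 1)"
    and dff_add: "x \<in> gr L k \<Longrightarrow> y \<in> gr L k \<Longrightarrow> dff L k (x + y) = dff L k x + dff L k y"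
    and dff_scale: "x \<in> gr L k \<Longrightarrow> dff L k (scl L c x) = scl L c (dff L k x)"
    and dff_dff: "x \<in> gr L k \<Longrightarrow> dff L (k - 1) (dff L k x) = 0"
    and dff_brk: "x \<in> gr L i \<Longrightarrow> y \<in> gr L j \<Longrightarrow>
      dff L (i + j) (brk L i j x y) =
      brk L (i - 1) j (dff L i x) y + ksign i (brk L i (j - 1) x (dff L j y))"

definition cycles :: "'a::ab_group_add dgl_data \<Rightarrow> int \<Rightarrow> 'a set" where
  "cycles L k = {x \<in> gr L k. dff L k x = 0}"

definition boundaries :: "'a::ab_group_add dgl_data \<Rightarrow> int \<Rightarrow> 'a set" where
  "boundaries L k = dff L (k + 1) ` gr L (k + 1)"

definition hclass :: "'a::ab_group_add dgl_data \<Rightarrow> int \<Rightarrow> 'a \<Rightarrow> 'a set" where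
  "hclass L k x = {x + b | b. b \<in> boundaries L k}"

definition homology :: "'a::ab_group_add dgl_data \<Rightarrow> int \<Rightarrow> 'a set set" where
  "homology L k = hclass L k ` cycles L k"

definition dgla_hom ::
  "'a::ab_group_add dgl_data \<Rightarrow> 'b::ab_group_add dgl_data \<Rightarrow> (int \<Rightarrow> 'a \<Rightarrow> 'b) \<Rightarrow> bool" where
  "dgla_hom L M f \<longleftrightarrow>
    (\<forall>k. \<forall>x\<in>gr L k. f k x \<in> gr M k) \<and>
    (\<forall>k. \<forall>x\<in>gr L k. \<forall>y\<in>gr L k. f k (x + y) = f k x + f k y) \<and>
    (\<forall>k c. \<forall>x\<in>gr L k. f k (scl L c x) = scl M c (f k x)) \<and>
    (\<forall>i j. \<forall>x\<in>gr L i. \<forall>y\<in>gr L j. f (i + j) (brk L i j x y) = brk M i j (f i x) (f j y)) \<and>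
    (\<forall>k. \<forall>x\<in>gr L k. f (k - 1) (dff L k x) = dff M k (f k x))"

text \<open>The map induced on homology; the union is over the representatives of the class \<open>C\<close>, all of
  which are sent to the same class.\<close>

definition homology_map ::
  "'b::ab_group_add dgl_data \<Rightarrow> (int \<Rightarrow> 'a \<Rightarrow> 'b) \<Rightarrow> int \<Rightarrow> 'a set \<Rightarrow> 'b set" where
  "homology_map M f k C = (\<Union>x\<in>C. hclass M k (f k x))"

definition quasi_iso ::
  "'a::ab_group_add dgl_data \<Rightarrow> 'b::ab_group_add dgl_data \<Rightarrow> (int \<Rightarrow> 'a \<Rightarrow> 'b) \<Rightarrow> bool" where
  "quasi_iso L M f \<longleftrightarrow> dgla_hom L M f \<and>
    (\<forall>k. bij_betw (homology_map M f k) (homology L k) (homology M k))"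

definition quasi_iso_step :: "'a::ab_group_add dgl_data \<Rightarrow> 'b::ab_group_add dgl_data \<Rightarrow> bool" where
  "quasi_iso_step L M \<longleftrightarrow>
    dgla L \<and> dgla M \<and> ((\<exists>f. quasi_iso L M f) \<or> (\<exists>f. quasi_iso M L f))"

text \<open>Two reduced dg Lie algebras are Lie models of simply connected spaces of the same rational
  homotopy type iff a zigzag of quasi-isomorphisms joins them.  The intermediate terms live in the
  type \<open>'c\<close>; a statement quantifying over zigzags has to be made for every \<open>'c\<close>.\<close>

definition quasi_isomorphic ::
  "'c::ab_group_add itself \<Rightarrow> 'a::ab_group_add dgl_data \<Rightarrow> 'b::ab_group_add dgl_data \<Rightarrow> bool" where
  "quasi_isomorphic (_ :: 'c itself) L M \<longleftrightarrow>
    (\<exists>P Q :: 'c dgl_data. quasi_iso_step L P \<and> quasi_iso_step\<^sup>*\<^sup>* P Q \<and> quasi_iso_step Q M)"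


section \<open>Lie models of products of Eilenberg--MacLane spaces\<close>

text \<open>The Lie model of $K(\mathbb{Q}^r, m)$: its homology is
  $\pi_*(\Omega K(\mathbb{Q}^r,m)) = \mathbb{Q}^r$ in degree $m-1$.\<close>

definition em_dgl :: "nat \<Rightarrow> nat \<Rightarrow> (nat \<Rightarrow> rat) dgl_data" where
  "em_dgl r m = \<lparr>
     gr = (\<lambda>k. if k = int m - 1 then {v. \<forall>i\<ge>r. v i = 0} else {0}),
     scl = (\<lambda>c v i. c * v i),
     brk = (\<lambda>i j v w. 0),
     dff = (\<lambda>k v. 0)\<rparr>"

definition dgl_prod ::
  "'a::ab_group_add dgl_data \<Rightarrow> 'b::ab_group_add dgl_data \<Rightarrow> ('a \<times> 'b) dgl_data" where
  "dgl_prod L M = \<lparr>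
     gr = (\<lambda>k. gr L k \<times> gr M k),
     scl = (\<lambda>c v. (scl L c (fst v), scl M c (snd v))),
     brk = (\<lambda>i j v w. (brk L i j (fst v) (fst w), brk M i j (snd v) (snd w))),
     dff = (\<lambda>k v. (dff L k (fst v), dff M k (snd v)))\<rparr>"


section \<open>Free graded commutative algebras\<close>

text \<open>Let V be the graded rational vector space with homogeneous basis \<open>B\<close>, where \<open>x \<in> B\<close> has
  degree \<open>dg x\<close>.  A basis of \<open>\<Lambda>V\<close> is given by the multisets over \<open>B\<close> in which no generator of odd
  degree is repeated; the multiset \<open>M\<close> stands for the product of its elements in increasing
  order.\<close>

type_synonym 'v lam = "'v multiset \<Rightarrow>\<^sub>0 rat"

definition mdeg :: "('v \<Rightarrow> nat) \<Rightarrow> 'v multiset \<Rightarrow> nat" where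
  "mdeg dg M = (\<Sum>x\<in>#M. dg x)"

definition lmonos :: "'v set \<Rightarrow> ('v \<Rightarrow> nat) \<Rightarrow> 'v multiset set" where
  "lmonos B dg = {M. set_mset M \<subseteq> B \<and> (\<forall>x. odd (dg x) \<longrightarrow> count M x \<le> 1)}"

definition Lam :: "'v set \<Rightarrow> ('v \<Rightarrow> nat) \<Rightarrow> 'v lam set" where
  "Lam B dg = {p. Poly_Mapping.keys p \<subseteq> lmonos B dg}"

definition Lam_deg :: "'v set \<Rightarrow> ('v \<Rightarrow> nat) \<Rightarrow> int \<Rightarrow> 'v lam set" where
  "Lam_deg B dg k = {p \<in> Lam B dg. \<forall>M\<in>Poly_Mapping.keys p. int (mdeg dg M) = k}"

definition Lam_decomposable :: "'v set \<Rightarrow> ('v \<Rightarrow> nat) \<Rightarrow> 'v lam set" where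
  "Lam_decomposable B dg = {p \<in> Lam B dg. \<forall>M\<in>Poly_Mapping.keys p. 2 \<le> size M}"

definition gen :: "'v \<Rightarrow> 'v lam" where
  "gen x = Poly_Mapping.single {#x#} 1"

definition lscale :: "rat \<Rightarrow> 'v lam \<Rightarrow> 'v lam" where
  "lscale c = Poly_Mapping.map (\<lambda>a. c * a)"

text \<open>Sorting the concatenation of the ordered products of \<open>M\<close> and \<open>N\<close> costs a factor -1 for each
  inversion between generators of odd degree, and gives 0 if \<open>M\<close> and \<open>N\<close> share such a generator.\<close>

definition mono_sign :: "('v::linorder \<Rightarrow> nat) \<Rightarrow> 'v multiset \<Rightarrow> 'v multiset \<Rightarrow> rat" where
  "mono_sign dg M N =
    (if \<exists>x\<in>set_mset M \<inter> set_mset N. odd (dg x) then 0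
     else (- 1) ^ card {(x, y). x \<in># M \<and> y \<in># N \<and> odd (dg x) \<and> odd (dg y) \<and> y < x})"

definition lmult :: "('v::linorder \<Rightarrow> nat) \<Rightarrow> 'v lam \<Rightarrow> 'v lam \<Rightarrow> 'v lam" where
  "lmult dg p q =
    (\<Sum>M\<in>Poly_Mapping.keys p. \<Sum>N\<in>Poly_Mapping.keys q.
       Poly_Mapping.single (M + N)
         (mono_sign dg M N * Poly_Mapping.lookup p M * Poly_Mapping.lookup q N))"


section \<open>Sullivan minimal models and their derivations\<close>

text \<open>Derivations of \<open>\<Lambda>V\<close> lowering degree by \<open>k\<close>, extended by 0 outside the carrier \<open>\<Lambda>V\<close>.\<close>

definition Der :: "'v::linorder set \<Rightarrow> ('v \<Rightarrow> nat) \<Rightarrow> int \<Rightarrow> ('v lam \<Rightarrow> 'v lam) set" where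
  "Der B dg k = {\<theta>.
    (\<forall>p. p \<notin> Lam B dg \<longrightarrow> \<theta> p = 0) \<and>
    (\<forall>m. \<forall>p\<in>Lam_deg B dg m. \<theta> p \<in> Lam_deg B dg (m - k)) \<and>
    (\<forall>p\<in>Lam B dg. \<forall>q\<in>Lam B dg. \<theta> (p + q) = \<theta> p + \<theta> q) \<and>
    (\<forall>c. \<forall>p\<in>Lam B dg. \<theta> (lscale c p) = lscale c (\<theta> p)) \<and>
    (\<forall>m. \<forall>p\<in>Lam_deg B dg m. \<forall>q\<in>Lam B dg.
       \<theta> (lmult dg p q) = lmult dg (\<theta> p) q + ksign (k * m) (lmult dg p (\<theta> q)))}"

text \<open>The minimal Sullivan algebras \<open>(\<Lambda>V, d)\<close> with V concentrated in degrees at least 2, that is,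
  the minimal models of simply connected spaces.  The nilpotence condition on a Sullivan algebra is
  automatic here: by decomposability and \<open>V\<^sup>1 = 0\<close>, the differential of a generator only involves
  generators of smaller degree.\<close>

definition sc_minimal_model ::
  "'v::linorder set \<Rightarrow> ('v \<Rightarrow> nat) \<Rightarrow> ('v lam \<Rightarrow> 'v lam) \<Rightarrow> bool" where
  "sc_minimal_model B dg d \<longleftrightarrow>
    (\<forall>x\<in>B. 2 \<le> dg x) \<and>
    d \<in> Der B dg (- 1) \<and>
    (\<forall>p\<in>Lam B dg. d (d p) = 0) \<and>
    (\<forall>x\<in>B. d (gen x) \<in> Lam_decomposable B dg)"

text \<open>For a simply connected space X with rational homology of finite type, \<open>V\<^sup>k\<close> is dual to
  $\pi_k(X) \otimes \mathbb{Q}$.\<close>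

definition pi_finite :: "'v set \<Rightarrow> ('v \<Rightarrow> nat) \<Rightarrow> bool" where
  "pi_finite B dg \<longleftrightarrow> finite (dg ` B)"

text \<open>Each $H^k(\Lambda V, d)$ (which is $H^k(X;\mathbb{Q})$, the dual of $H_k(X;\mathbb{Q})$) is
  finite-dimensional.\<close>

definition cohomology_finite_type ::
  "'v set \<Rightarrow> ('v \<Rightarrow> nat) \<Rightarrow> ('v lam \<Rightarrow> 'v lam) \<Rightarrow> bool" where
  "cohomology_finite_type B dg d \<longleftrightarrow>
    (\<forall>k. \<exists>S. finite S \<and> S \<subseteq> {p \<in> Lam_deg B dg k. d p = 0} \<and>
       {p \<in> Lam_deg B dg k. d p = 0} \<subseteq> module.span lscale (d ` Lam_deg B dg (k - 1) \<union> S))"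

text \<open>The dg Lie algebra \<open>Der'(\<Lambda>V)\<close> with the graded commutator bracket and \<open>D = [d, -]\<close>.\<close>

definition der_diff ::
  "('v lam \<Rightarrow> 'v lam) \<Rightarrow> int \<Rightarrow> ('v lam \<Rightarrow> 'v lam) \<Rightarrow> 'v lam \<Rightarrow> 'v lam" where
  "der_diff d k \<theta> = (d \<circ> \<theta>) - ksign k (\<theta> \<circ> d)"

definition der_dgl ::
  "'v::linorder set \<Rightarrow> ('v \<Rightarrow> nat) \<Rightarrow> ('v lam \<Rightarrow> 'v lam) \<Rightarrow> ('v lam \<Rightarrow> 'v lam) dgl_data" where
  "der_dgl B dg d = \<lparr>
     gr = (\<lambda>k. if k > 1 then Der B dg k
               else if k = 1 then {\<theta> \<in> Der B dg 1. der_diff d 1 \<theta> = 0}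
               else {0}),
     scl = (\<lambda>c \<theta> p. lscale c (\<theta> p)),
     brk = (\<lambda>i j \<theta> \<eta>. (\<theta> \<circ> \<eta>) - ksign (i * j) (\<eta> \<circ> \<theta>)),
     dff = der_diff d\<rparr>"

end

theory Submission
  imports Defs "HOL-Library.Product_Lexorder"
begin

text \<open>Suppose that $H_*(\mathrm{Der}'(\Lambda V))$ is concentrated in the degrees $n - 1$ and $n$ and
  does not vanish there.  If $v$ is a generator of top degree, then $\psi = \partial/\partial v$ is a
  cycle and not a boundary, so $V$ has top degree $n$.  A nonzero cycle $\phi$ of degree $n - 1$ satisfies
  $\phi(x) \neq 0$ for some generator $x$ of degree $n - 1$ and vanishes on decomposables of that degree.

  Let $\Lambda V \otimes \Lambda \bar V$ be the acyclic closure of $\Lambda V$.  As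
  $H_j(\mathrm{Der}') = 0$ for $1 \le j \le n - 2$, the assignment $1 \mapsto \psi$ extends, one cell
  (monomial in $\bar V$) at a time, to a $\Lambda V$-linear chain map from the cells of degree at most
  $n - 2$ to the derivations.  Its value at $\bar x$ is a derivation $\zeta$ of degree 2, and
  $D \bar x = x + {}$(decomposables) gives $[d, \zeta](v) = x + {}$(decomposables), whence
  $\phi([d, \zeta](v)) \neq 0$.  But $[\phi, \zeta]$ has degree $n + 1$, so it vanishes, and
  $[d, \phi] = 0$; hence $\phi([d, \zeta](v)) = 0$.\<close>

section \<open>Linear algebra of monomials\<close>

text \<open>If \<open>d x = 0\<close>, the argument is short: \<open>x \<psi>\<close> is a cycle of
  degree n - (n - 1) = 1, hence equal to [d, \<zeta>] for some \<zeta> of degree 2, and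
  [d, \<zeta>](v) = x. In general \<open>x \<psi>\<close> has differential
  \<open>(d x) \<psi>\<close>, and cancelling this calls for corrections that need further
  corrections. The acyclic closure organises them: D of the suspension of x is x completed to a
  cycle, and a chain map that is linear over the algebra carries it to the corrected derivation. A
  cell of degree e goes to a derivation of degree n - e, so the obstruction to extending over it is
  a cycle of degree n - e - 1. This lies between 1 and n - 2 exactly for 1 \<le> e \<le> n - 2. The
  suspension of x has degree n - 2, so it is the last kind of cell that can be reached. The
  differential of the closure is built by induction on the degree of the generators, and each stage
  is a derivation whose square vanishes only up to that degree. Stage n is enough because V stops in
  degree n.\<close>

lemma lookup_lscale [simp]: "Poly_Mapping.lookup (lscale c p) M = c * Poly_Mapping.lookup p M"
  by (simp add: lscale_def Poly_Mapping.map.rep_eq when_def)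

lemma lscale_zero_right [simp]: "lscale c 0 = 0"
  and lscale_zero_left [simp]: "lscale 0 p = 0"
  and lscale_one [simp]: "lscale 1 p = p"
  and lscale_add: "lscale c (p + q) = lscale c p + lscale c q"
  and lscale_diff: "lscale c (p - q) = lscale c p - lscale c q"
  and lscale_left_add: "lscale (c + c') p = lscale c p + lscale c' p"
  and lscale_lscale [simp]: "lscale c (lscale c' p) = lscale (c * c') p"
  and lscale_minus_one: "lscale (- 1) p = - p"
  and lscale_single [simp]: "lscale c (Poly_Mapping.single M e) = Poly_Mapping.single M (c * e)"
  by (auto intro!: poly_mapping_eqI simp: lookup_add lookup_minus algebra_simps lookup_single when_def)

lemma lscale_sum: "lscale c (sum f A) = (\<Sum>x\<in>A. lscale c (f x))"
  by (induction A rule: infinite_finite_induct) (auto simp: lscale_add)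

lemma lscale_eq_0_iff: "lscale c p = 0 \<longleftrightarrow> c = 0 \<or> p = 0"
  by (auto simp: poly_mapping_eq_iff fun_eq_iff)

text \<open>A scalar form of \<open>ksign\<close>: signs then multiply, cancel and commute with
  linear maps by rational arithmetic.\<close>

definition psign :: "int \<Rightarrow> rat" where
  "psign k = (if even k then 1 else - 1)"

lemma ksign_eq_lscale: "ksign k p = lscale (psign k) p"
  by (auto simp: ksign_def psign_def lscale_minus_one)

lemma psign_mult_self [simp]: "psign k * psign k = 1"
  and psign_add: "psign (k + l) = psign k * psign l"
  and psign_diff: "psign (k - l) = psign k * psign l"
  and psign_uminus [simp]: "psign (- k) = psign k"
  and psign_0 [simp]: "psign 0 = 1"
  and psign_1 [simp]: "psign 1 = - 1"
  by (auto simp: psign_def)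

definition lspan :: "'v multiset set \<Rightarrow> 'v lam set" where
  "lspan X = {p. Poly_Mapping.keys p \<subseteq> X}"

lemma lspan_iff: "p \<in> lspan X \<longleftrightarrow> (\<forall>M. Poly_Mapping.lookup p M \<noteq> 0 \<longrightarrow> M \<in> X)"
  by (auto simp: lspan_def in_keys_iff)

lemma zero_in_lspan [simp]: "0 \<in> lspan X"
  by (simp add: lspan_iff)

lemma add_in_lspan: "p \<in> lspan X \<Longrightarrow> q \<in> lspan X \<Longrightarrow> p + q \<in> lspan X"
  unfolding lspan_iff lookup_add by (metis add.right_neutral)

lemma lscale_in_lspan: "p \<in> lspan X \<Longrightarrow> lscale c p \<in> lspan X"
  by (simp add: lspan_iff)

lemma uminus_in_lspan: "p \<in> lspan X \<Longrightarrow> - p \<in> lspan X"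
  by (simp add: lspan_iff)

lemma diff_in_lspan: "p \<in> lspan X \<Longrightarrow> q \<in> lspan X \<Longrightarrow> p - q \<in> lspan X"
  using add_in_lspan[of p X "- q"] by (simp add: uminus_in_lspan)

lemma single_in_lspan: "M \<in> X \<Longrightarrow> Poly_Mapping.single M c \<in> lspan X"
  by (simp add: lspan_def)

lemma lspan_mono: "X \<subseteq> Y \<Longrightarrow> lspan X \<subseteq> lspan Y"
  by (auto simp: lspan_def)

lemma lspan_Int: "lspan (X \<inter> Y) = lspan X \<inter> lspan Y"
  by (auto simp: lspan_def)

lemma lspan_empty: "lspan {} = {0}"
  by (auto simp: lspan_iff intro!: poly_mapping_eqI)

lemma ksign_in_lspan: "p \<in> lspan X \<Longrightarrow> ksign k p \<in> lspan X"
  by (simp add: ksign_eq_lscale lscale_in_lspan)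

lemma sum_in_lspan: "(\<And>i. i \<in> I \<Longrightarrow> f i \<in> lspan X) \<Longrightarrow> sum f I \<in> lspan X"
  by (induction I rule: infinite_finite_induct) (auto intro: add_in_lspan)

lemma lam_expand:
  "p = (\<Sum>M\<in>Poly_Mapping.keys p. Poly_Mapping.single M (Poly_Mapping.lookup p M))"
  by (rule poly_mapping_eqI) (simp add: lookup_sum lookup_single when_def in_keys_iff)

text \<open>The case \<open>add\<close> also supplies membership of both summands, because
  derivations are additive only on their carrier.\<close>

lemma lspan_induct [consumes 1, case_names single zero add]:
  assumes "p \<in> lspan X"
    and "\<And>M c. M \<in> X \<Longrightarrow> P (Poly_Mapping.single M c)"
    and "P 0"
    and "\<And>p q. p \<in> lspan X \<Longrightarrow> q \<in> lspan X \<Longrightarrow> P p \<Longrightarrow> P q \<Longrightarrow> P (p + q)"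
  shows "P p"
proof -
  have "sum f I \<in> lspan X \<and> P (sum f I)"
    if "finite I" "\<And>i. i \<in> I \<Longrightarrow> f i \<in> lspan X \<and> P (f i)" for f :: "'a multiset \<Rightarrow> 'a lam" and I
    using that
  proof (induction I rule: finite_induct)
    case (insert i I)
    then have "f i \<in> lspan X" "P (f i)" "sum f I \<in> lspan X" "P (sum f I)" by auto
    with insert(1,2) show ?case by (simp add: add_in_lspan assms(4))
  qed (simp add: assms(3))
  moreover have "Poly_Mapping.single M (Poly_Mapping.lookup p M) \<in> lspan X \<and>
      P (Poly_Mapping.single M (Poly_Mapping.lookup p M))" if "M \<in> Poly_Mapping.keys p" for M
  proof -
    have "M \<in> X" using that assms(1) by (auto simp: lspan_def)
    then show ?thesis by (intro conjI assms(2) single_in_lspan)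
  qed
  ultimately have "P (\<Sum>M\<in>Poly_Mapping.keys p. Poly_Mapping.single M (Poly_Mapping.lookup p M))"
    by (metis (no_types, lifting) finite_keys)
  then show ?thesis
    using lam_expand[of p] by metis
qed

section \<open>Linear extension from the monomial basis\<close>

definition lext :: "('v multiset \<Rightarrow> 'w lam) \<Rightarrow> 'v lam \<Rightarrow> 'w lam" where
  "lext g p = (\<Sum>M\<in>Poly_Mapping.keys p. lscale (Poly_Mapping.lookup p M) (g M))"

lemma lext_superset:
  assumes "finite S" "Poly_Mapping.keys p \<subseteq> S"
  shows "lext g p = (\<Sum>M\<in>S. lscale (Poly_Mapping.lookup p M) (g M))"
  unfolding lext_def using assms
  by (intro sum.mono_neutral_left) (auto simp: in_keys_iff)

lemma lext_zero [simp]: "lext g 0 = 0"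
  by (simp add: lext_def)

lemma lext_single [simp]: "lext g (Poly_Mapping.single M c) = lscale c (g M)"
  by (simp add: lext_def)

lemma lext_add: "lext g (p + q) = lext g p + lext g q"
proof -
  let ?S = "Poly_Mapping.keys p \<union> Poly_Mapping.keys q"
  have "Poly_Mapping.keys (p + q) \<subseteq> ?S"
    by (rule keys_add)
  then show ?thesis
    by (simp add: lext_superset[of ?S] lookup_add lscale_left_add sum.distrib)
qed

lemma lext_lscale: "lext g (lscale c p) = lscale c (lext g p)"
proof -
  have "Poly_Mapping.keys (lscale c p) \<subseteq> Poly_Mapping.keys p"
    by (auto simp: in_keys_iff)
  then show ?thesis
    by (simp add: lext_superset[of "Poly_Mapping.keys p"] lscale_sum)
qed

lemma lext_uminus: "lext g (- p) = - lext g p"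
  by (metis lext_lscale lscale_minus_one)

lemma lext_cong: "(\<And>M. M \<in> Poly_Mapping.keys p \<Longrightarrow> g M = h M) \<Longrightarrow> lext g p = lext h p"
  by (simp add: lext_def)

lemma lext_add_fun: "lext (\<lambda>M. g M + h M) p = lext g p + lext h p"
  by (simp add: lext_def lscale_add sum.distrib)

lemma lext_lscale_fun: "lext (\<lambda>M. lscale c (g M)) p = lscale c (lext g p)"
  by (simp add: lext_def lscale_sum mult.commute)

lemma lext_zero_fun: "lext (\<lambda>M. 0) p = 0"
  by (simp add: lext_def)

lemma lext_in_lspan:
  "(\<And>M. M \<in> Poly_Mapping.keys p \<Longrightarrow> g M \<in> lspan X) \<Longrightarrow> lext g p \<in> lspan X"
  by (auto simp: lext_def intro!: sum_in_lspan lscale_in_lspan)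


section \<open>The graded commutative product\<close>

definition odds :: "('v \<Rightarrow> nat) \<Rightarrow> 'v multiset \<Rightarrow> 'v set" where
  "odds dg M = {x \<in> set_mset M. odd (dg x)}"

text \<open>The sign of a product of monomials depends only on the sets of odd generators. On sets
  the inversion count is additive in disjoint unions on either side.\<close>

definition inversions :: "'v::linorder set \<Rightarrow> 'v set \<Rightarrow> nat" where
  "inversions X Y = card {(x, y). x \<in> X \<and> y \<in> Y \<and> y < x}"

lemma finite_odds [simp]: "finite (odds dg M)"
  by (simp add: odds_def)

lemma odds_empty [simp]: "odds dg {#} = {}"
  by (simp add: odds_def)

lemma odds_single [simp]: "odds dg {#x#} = (if odd (dg x) then {x} else {})"
  by (auto simp: odds_def)

lemma odds_add [simp]: "odds dg (M + N) = odds dg M \<union> odds dg N"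
  by (auto simp: odds_def)

lemma mono_sign_eq:
  "mono_sign dg M N = (if odds dg M \<inter> odds dg N = {} then (- 1) ^ inversions (odds dg M) (odds dg N) else 0)"
proof -
  have *: "{(x, y). x \<in># M \<and> y \<in># N \<and> odd (dg x) \<and> odd (dg y) \<and> y < x} =
    {(x, y). x \<in> odds dg M \<and> y \<in> odds dg N \<and> y < x}"
    by (auto simp: odds_def)
  show ?thesis
    unfolding mono_sign_def inversions_def * by (auto simp: odds_def)
qed

lemma inversions_Un_left:
  assumes "finite X" "finite X'" "finite Y" "X \<inter> X' = {}"
  shows "inversions (X \<union> X') Y = inversions X Y + inversions X' Y"
proof -
  have *: "{(x, y). x \<in> X \<union> X' \<and> y \<in> Y \<and> y < x} =
    {(x, y). x \<in> X \<and> y \<in> Y \<and> y < x} \<union> {(x, y). x \<in> X' \<and> y \<in> Y \<and> y < x}"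
    by auto
  have "finite {(x, y). x \<in> Z \<and> y \<in> Y \<and> y < x}" if "finite Z" for Z
    by (rule finite_subset[of _ "Z \<times> Y"]) (use that assms in auto)
  then show ?thesis
    unfolding inversions_def * using assms by (subst card_Un_disjoint) auto
qed

lemma inversions_Un_right:
  assumes "finite X" "finite Y" "finite Y'" "Y \<inter> Y' = {}"
  shows "inversions X (Y \<union> Y') = inversions X Y + inversions X Y'"
proof -
  have *: "{(x, y). x \<in> X \<and> y \<in> Y \<union> Y' \<and> y < x} =
    {(x, y). x \<in> X \<and> y \<in> Y \<and> y < x} \<union> {(x, y). x \<in> X \<and> y \<in> Y' \<and> y < x}"
    by auto
  have "finite {(x, y). x \<in> X \<and> y \<in> Z \<and> y < x}" if "finite Z" for Z
    by (rule finite_subset[of _ "X \<times> Z"]) (use that assms in auto)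
  then show ?thesis
    unfolding inversions_def * using assms by (subst card_Un_disjoint) auto
qed

text \<open>Each pair in the product of disjoint sets is inverted in exactly one of the two orders.
  Modulo 2 this is the Koszul sign rule.\<close>

lemma inversions_swap:
  assumes "finite X" "finite Y" "X \<inter> Y = {}"
  shows "inversions X Y + inversions Y X = card X * card Y"
proof -
  have "inversions Y X = card {(x, y). x \<in> X \<and> y \<in> Y \<and> x < y}"
    unfolding inversions_def
    by (rule bij_betw_same_card[of "\<lambda>(x, y). (y, x)"]) (auto simp: bij_betw_def inj_on_def)
  moreover have "card X * card Y =
      card {(x, y). x \<in> X \<and> y \<in> Y \<and> y < x} + card {(x, y). x \<in> X \<and> y \<in> Y \<and> x < y}"
  proof -
    have fin: "finite {(x, y). x \<in> X \<and> y \<in> Y \<and> R x y}" for R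
      by (rule finite_subset[of _ "X \<times> Y"]) (use assms in auto)
    have "X \<times> Y = {(x, y). x \<in> X \<and> y \<in> Y \<and> y < x} \<union> {(x, y). x \<in> X \<and> y \<in> Y \<and> x < y}"
      using assms by (auto simp: neq_iff)
    then have "card (X \<times> Y) =
        card ({(x, y). x \<in> X \<and> y \<in> Y \<and> y < x} \<union> {(x, y). x \<in> X \<and> y \<in> Y \<and> x < y})"
      by (rule arg_cong)
    also have "\<dots> = card {(x, y). x \<in> X \<and> y \<in> Y \<and> y < x} +
        card {(x, y). x \<in> X \<and> y \<in> Y \<and> x < y}"
      by (rule card_Un_disjoint[OF fin fin]) auto
    finally show ?thesis
      by (simp add: card_cartesian_product)
  qed
  ultimately show ?thesis
    by (simp add: inversions_def)
qed

text \<open>The cocycle identity behind associativity. Both sides vanish unless the three odd sets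
  are pairwise disjoint, and then both exponents are the sum of the three pairwise inversion
  counts.\<close>

lemma mono_sign_assoc:
  "mono_sign dg M N * mono_sign dg (M + N) P = mono_sign dg N P * mono_sign dg M (N + P)"
  by (auto simp: mono_sign_eq inversions_Un_left inversions_Un_right power_add Int_Un_distrib Int_Un_distrib2)

lemma mono_sign_empty [simp]: "mono_sign dg {#} M = 1" "mono_sign dg M {#} = 1"
  by (simp_all add: mono_sign_eq inversions_def)

lemma lmult_eq_lext:
  "lmult dg p q = lext (\<lambda>M. lext (\<lambda>N. Poly_Mapping.single (M + N) (mono_sign dg M N)) q) p"
  by (simp add: lmult_def lext_def lscale_sum mult_ac)

lemma lmult_single_single:
  "lmult dg (Poly_Mapping.single M a) (Poly_Mapping.single N b) =
    Poly_Mapping.single (M + N) (a * b * mono_sign dg M N)"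
  by (simp add: lmult_eq_lext mult_ac)

lemma lmult_add_left: "lmult dg (p + p') q = lmult dg p q + lmult dg p' q"
  and lmult_add_right: "lmult dg p (q + q') = lmult dg p q + lmult dg p q'"
  and lmult_lscale_left: "lmult dg (lscale c p) q = lscale c (lmult dg p q)"
  and lmult_lscale_right: "lmult dg p (lscale c q) = lscale c (lmult dg p q)"
  and lmult_zero_left [simp]: "lmult dg 0 q = 0"
  and lmult_zero_right [simp]: "lmult dg p 0 = 0"
  and lmult_uminus_left: "lmult dg (- p) q = - lmult dg p q"
  and lmult_uminus_right: "lmult dg p (- q) = - lmult dg p q"
  by (simp_all add: lmult_eq_lext lext_add lext_lscale lext_add_fun lext_lscale_fun lext_zero_fun
      lext_uminus flip: lscale_minus_one)

lemma lmult_diff_left: "lmult dg (p - p') q = lmult dg p q - lmult dg p' q"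
  and lmult_diff_right: "lmult dg p (q - q') = lmult dg p q - lmult dg p q'"
  using lmult_add_left[of dg p "- p'"] lmult_add_right[of dg p q "- q'"]
  by (simp_all add: lmult_uminus_left lmult_uminus_right)

lemma lmult_ksign_left: "lmult dg (ksign k p) q = ksign k (lmult dg p q)"
  and lmult_ksign_right: "lmult dg p (ksign k q) = ksign k (lmult dg p q)"
  by (simp_all add: ksign_eq_lscale lmult_lscale_left lmult_lscale_right)

lemma lmult_sum_left: "lmult dg (sum f I) q = (\<Sum>i\<in>I. lmult dg (f i) q)"
  by (induction I rule: infinite_finite_induct) (auto simp: lmult_add_left)

lemma lmult_sum_right: "lmult dg p (sum f I) = (\<Sum>i\<in>I. lmult dg p (f i))"
  by (induction I rule: infinite_finite_induct) (auto simp: lmult_add_right)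

lemma lmult_one_left [simp]: "lmult dg (Poly_Mapping.single {#} c) q = lscale c q"
proof -
  have "q \<in> lspan UNIV" by (simp add: lspan_def)
  then show ?thesis
    by (induction q rule: lspan_induct) (auto simp: lmult_single_single lmult_add_right lscale_add)
qed

lemma lmult_one_right [simp]: "lmult dg q (Poly_Mapping.single {#} c) = lscale c q"
proof -
  have "q \<in> lspan UNIV" by (simp add: lspan_def)
  then show ?thesis
    by (induction q rule: lspan_induct) (auto simp: lmult_single_single lmult_add_left lscale_add mult.commute)
qed

lemma lmult_1_left [simp]: "lmult dg 1 q = q"
  and lmult_1_right [simp]: "lmult dg q 1 = q"
  using lmult_one_left[of dg 1 q] lmult_one_right[of dg q 1] by simp_all

lemma lmult_assoc: "lmult dg (lmult dg p q) r = lmult dg p (lmult dg q r)"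
proof -
  have "p \<in> lspan UNIV" "q \<in> lspan UNIV" "r \<in> lspan UNIV" by (simp_all add: lspan_def)
  from this(1) show ?thesis
  proof (induction p rule: lspan_induct)
    case (single M a)
    from \<open>q \<in> lspan UNIV\<close> show ?case
    proof (induction q rule: lspan_induct)
      case (single N b)
      from \<open>r \<in> lspan UNIV\<close> show ?case
      proof (induction r rule: lspan_induct)
        case (single P c)
        then show ?case
          using mono_sign_assoc[of dg M N P] by (simp add: lmult_single_single add.assoc mult_ac)
      qed (auto simp: lmult_add_right)
    qed (auto simp: lmult_add_right lmult_add_left)
  qed (auto simp: lmult_add_left)
qed

section \<open>Admissible monomials, degrees and graded commutativity\<close>

lemma mdeg_empty [simp]: "mdeg dg {#} = 0"
  and mdeg_add [simp]: "mdeg dg (M + N) = mdeg dg M + mdeg dg N"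
  and mdeg_single [simp]: "mdeg dg {#x#} = dg x"
  and mdeg_add_mset [simp]: "mdeg dg (add_mset x M) = dg x + mdeg dg M"
  by (simp_all add: mdeg_def)

lemma empty_in_lmonos [simp]: "{#} \<in> lmonos B dg"
  by (simp add: lmonos_def)

lemma single_in_lmonos [simp]: "{#x#} \<in> lmonos B dg \<longleftrightarrow> x \<in> B"
  by (auto simp: lmonos_def)

lemma add_in_lmonos_iff:
  "M + N \<in> lmonos B dg \<longleftrightarrow> M \<in> lmonos B dg \<and> N \<in> lmonos B dg \<and> odds dg M \<inter> odds dg N = {}"
proof
  assume "M + N \<in> lmonos B dg"
  then have 1: "set_mset (M + N) \<subseteq> B" and 2: "\<And>x. odd (dg x) \<Longrightarrow> count M x + count N x \<le> 1"
    by (auto simp: lmonos_def)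
  have "x \<notin># N" if "x \<in># M" "odd (dg x)" for x
  proof -
    have "count M x \<noteq> 0" using that(1) by simp
    then have "count N x = 0" using 2[OF that(2)] by linarith
    then show ?thesis by (simp add: not_in_iff)
  qed
  moreover have "count M x \<le> 1" "count N x \<le> 1" if "odd (dg x)" for x
    using 2[OF that] by auto
  ultimately show "M \<in> lmonos B dg \<and> N \<in> lmonos B dg \<and> odds dg M \<inter> odds dg N = {}"
    using 1 by (auto simp: lmonos_def odds_def)
next
  assume *: "M \<in> lmonos B dg \<and> N \<in> lmonos B dg \<and> odds dg M \<inter> odds dg N = {}"
  have "count M x + count N x \<le> 1" if "odd (dg x)" for x
  proof (cases "x \<in># M")
    case True
    then have "x \<notin># N" using * that by (auto simp: odds_def)
    then show ?thesis using * that by (auto simp: lmonos_def not_in_iff)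
  qed (use * that in \<open>auto simp: lmonos_def not_in_iff\<close>)
  then show "M + N \<in> lmonos B dg" using * by (auto simp: lmonos_def)
qed

lemma mono_sign_nonzero_iff: "mono_sign dg M N \<noteq> 0 \<longleftrightarrow> odds dg M \<inter> odds dg N = {}"
  by (simp add: mono_sign_eq)

text \<open>Even generators do not affect the parity and odd ones occur at most once. This turns the
  cardinalities of \<open>inversions_swap\<close> into the degrees of the Koszul sign.\<close>

lemma even_mdeg:
  assumes "M \<in> lmonos B dg"
  shows "even (mdeg dg M) \<longleftrightarrow> even (card (odds dg M))"
  using assms
proof (induction M)
  case (add x M)
  have *: "{#x#} + M \<in> lmonos B dg"
    using add.prems by simp
  then have M: "M \<in> lmonos B dg" and disj: "odds dg {#x#} \<inter> odds dg M = {}"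
    unfolding add_in_lmonos_iff by auto
  have "card (odds dg (add_mset x M)) = card (odds dg {#x#}) + card (odds dg M)"
    using disj card_Un_disjoint[of "odds dg {#x#}" "odds dg M"] odds_add[of dg "{#x#}" M] by simp
  moreover have "even (card (odds dg {#x#})) = even (dg x)"
    by simp
  ultimately show ?case
    using add.IH[OF M] by simp
qed simp

lemma Lam_eq_lspan: "Lam B dg = lspan (lmonos B dg)"
  by (simp add: Lam_def lspan_def)

lemma Lam_deg_eq_lspan: "Lam_deg B dg k = lspan {M \<in> lmonos B dg. int (mdeg dg M) = k}"
  by (auto simp: Lam_deg_def Lam_def lspan_def)

lemma Lam_decomposable_eq_lspan: "Lam_decomposable B dg = lspan {M \<in> lmonos B dg. 2 \<le> size M}"
  by (auto simp: Lam_decomposable_def Lam_def lspan_def)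

lemma Lam_deg_subset_Lam: "p \<in> Lam_deg B dg k \<Longrightarrow> p \<in> Lam B dg"
  by (simp add: Lam_deg_def)

lemmas Lam_simps = Lam_eq_lspan Lam_deg_eq_lspan Lam_decomposable_eq_lspan

text \<open>Pairs of monomials sharing an odd generator multiply to zero, so closure has to be
  checked only for the others. Degrees, decomposables and filtrations are all handled through this
  one rule.\<close>

lemma lmult_in_lspan:
  assumes "p \<in> lspan X" "q \<in> lspan Y"
    and "\<And>M N. M \<in> X \<Longrightarrow> N \<in> Y \<Longrightarrow> odds dg M \<inter> odds dg N = {} \<Longrightarrow> M + N \<in> Z"
  shows "lmult dg p q \<in> lspan Z"
  unfolding lmult_eq_lext
proof (intro lext_in_lspan)
  fix M N assume "M \<in> Poly_Mapping.keys p" "N \<in> Poly_Mapping.keys q"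
  with assms have MN: "M \<in> X" "N \<in> Y" by (auto simp: lspan_def)
  show "Poly_Mapping.single (M + N) (mono_sign dg M N) \<in> lspan Z"
  proof (cases "odds dg M \<inter> odds dg N = {}")
    case True
    then show ?thesis using MN assms(3) by (intro single_in_lspan) auto
  next
    case False
    then show ?thesis by (simp add: mono_sign_eq)
  qed
qed

lemma lmult_in_Lam: "p \<in> Lam B dg \<Longrightarrow> q \<in> Lam B dg \<Longrightarrow> lmult dg p q \<in> Lam B dg"
  unfolding Lam_simps by (erule (1) lmult_in_lspan) (simp add: add_in_lmonos_iff)

lemma lmult_in_Lam_deg:
  "p \<in> Lam_deg B dg k \<Longrightarrow> q \<in> Lam_deg B dg l \<Longrightarrow> lmult dg p q \<in> Lam_deg B dg (k + l)"
  unfolding Lam_simps by (erule (1) lmult_in_lspan) (simp add: add_in_lmonos_iff)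

lemma mono_sign_commute:
  assumes "M \<in> lmonos B dg" "N \<in> lmonos B dg"
  shows "mono_sign dg M N = psign (int (mdeg dg M) * int (mdeg dg N)) * mono_sign dg N M"
proof (cases "odds dg M \<inter> odds dg N = {}")
  case True
  have "even (inversions (odds dg M) (odds dg N) + inversions (odds dg N) (odds dg M)) \<longleftrightarrow>
      even (mdeg dg M * mdeg dg N)"
    using inversions_swap[OF _ _ True] even_mdeg[OF assms(1)] even_mdeg[OF assms(2)] by simp
  then show ?thesis
    using True by (auto simp: mono_sign_eq psign_def Int_commute minus_one_power_iff split: if_splits)
qed (auto simp: mono_sign_eq Int_commute)

lemma lmult_commute:
  assumes "p \<in> Lam_deg B dg k" "q \<in> Lam_deg B dg l"
  shows "lmult dg p q = ksign (k * l) (lmult dg q p)"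
  using assms(1) unfolding Lam_deg_eq_lspan
proof (induction p rule: lspan_induct)
  case (single M a)
  from assms(2) show ?case
    unfolding Lam_deg_eq_lspan
  proof (induction q rule: lspan_induct)
    case (single N b)
    then show ?case
      using mono_sign_commute[of M B dg N] \<open>M \<in> _\<close>
      by (auto simp: lmult_single_single ksign_eq_lscale mult_ac add.commute)
  qed (auto simp: lmult_add_left lmult_add_right ksign_eq_lscale lscale_add)
qed (auto simp: lmult_add_left lmult_add_right ksign_eq_lscale lscale_add)

section \<open>Derivations\<close>

lemma Der_outside: "\<theta> \<in> Der B dg k \<Longrightarrow> p \<notin> Lam B dg \<Longrightarrow> \<theta> p = 0"
  and Der_deg: "\<theta> \<in> Der B dg k \<Longrightarrow> p \<in> Lam_deg B dg m \<Longrightarrow> \<theta> p \<in> Lam_deg B dg (m - k)"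
  and Der_add: "\<theta> \<in> Der B dg k \<Longrightarrow> p \<in> Lam B dg \<Longrightarrow> q \<in> Lam B dg \<Longrightarrow> \<theta> (p + q) = \<theta> p + \<theta> q"
  and Der_lscale: "\<theta> \<in> Der B dg k \<Longrightarrow> p \<in> Lam B dg \<Longrightarrow> \<theta> (lscale c p) = lscale c (\<theta> p)"
  and Der_leibniz: "\<theta> \<in> Der B dg k \<Longrightarrow> p \<in> Lam_deg B dg m \<Longrightarrow> q \<in> Lam B dg \<Longrightarrow>
    \<theta> (lmult dg p q) = lmult dg (\<theta> p) q + ksign (k * m) (lmult dg p (\<theta> q))"
  by (auto simp: Der_def)

lemma zero_in_Lam [simp]: "0 \<in> Lam B dg"
  by (simp add: Lam_simps)

lemma Der_zero: "\<theta> \<in> Der B dg k \<Longrightarrow> \<theta> 0 = 0"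
  using Der_lscale[of \<theta> B dg k 0 0] by simp

lemma Der_uminus: "\<theta> \<in> Der B dg k \<Longrightarrow> p \<in> Lam B dg \<Longrightarrow> \<theta> (- p) = - \<theta> p"
  using Der_lscale[of \<theta> B dg k p "- 1"] by (simp add: lscale_minus_one)

lemma Der_diff:
  "\<theta> \<in> Der B dg k \<Longrightarrow> p \<in> Lam B dg \<Longrightarrow> q \<in> Lam B dg \<Longrightarrow> \<theta> (p - q) = \<theta> p - \<theta> q"
  using Der_add[of \<theta> B dg k p "- q"] Der_uminus[of \<theta> B dg k q]
  by (simp add: Lam_simps uminus_in_lspan)

lemma Der_Lam:
  assumes "\<theta> \<in> Der B dg k" "p \<in> Lam B dg"
  shows "\<theta> p \<in> Lam B dg"
  using assms(2) unfolding Lam_eq_lspan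
proof (induction p rule: lspan_induct)
  case (single M c)
  then have "Poly_Mapping.single M c \<in> Lam_deg B dg (int (mdeg dg M))"
    unfolding Lam_deg_eq_lspan by (intro single_in_lspan) simp
  from Lam_deg_subset_Lam[OF Der_deg[OF assms(1) this]] show ?case
    by (simp add: Lam_eq_lspan)
next
  case (add p q)
  then show ?case
    using Der_add[OF assms(1), of p q] by (simp add: Lam_eq_lspan add_in_lspan)
qed (simp add: Der_zero[OF assms(1)])

lemma Der_eq_lext:
  assumes "\<theta> \<in> Der B dg k" "p \<in> Lam B dg"
  shows "\<theta> p = lext (\<lambda>M. \<theta> (Poly_Mapping.single M 1)) p"
  using assms(2) unfolding Lam_eq_lspan
proof (induction p rule: lspan_induct)
  case (single M c)
  then have "Poly_Mapping.single M 1 \<in> Lam B dg"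
    by (simp add: Lam_eq_lspan single_in_lspan)
  from Der_lscale[OF assms(1) this, of c] show ?case by simp
next
  case (add p q)
  then show ?case
    using Der_add[OF assms(1), of p q] by (simp add: Lam_eq_lspan lext_add)
qed (simp add: Der_zero[OF assms(1)])

lemma Der_ext:
  assumes "\<theta> \<in> Der B dg k" "\<eta> \<in> Der B dg l"
    and "\<And>p. p \<in> Lam B dg \<Longrightarrow> \<theta> p = \<eta> p"
  shows "\<theta> = \<eta>"
  by (rule ext) (metis Der_outside assms)

text \<open>Both sides are bilinear once the degree of \<open>p\<close> is fixed, so monomials with
  coefficient 1 suffice.\<close>

lemma Der_leibniz_linearI:
  assumes "\<And>p q. p \<in> Lam B dg \<Longrightarrow> q \<in> Lam B dg \<Longrightarrow> \<theta> (p + q) = \<theta> p + \<theta> q"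
    and "\<And>c p. p \<in> Lam B dg \<Longrightarrow> \<theta> (lscale c p) = lscale c (\<theta> p)"
    and mono: "\<And>M N. M \<in> lmonos B dg \<Longrightarrow> N \<in> lmonos B dg \<Longrightarrow>
      \<theta> (lmult dg (Poly_Mapping.single M 1) (Poly_Mapping.single N 1)) =
      lmult dg (\<theta> (Poly_Mapping.single M 1)) (Poly_Mapping.single N 1) +
      ksign (k * int (mdeg dg M)) (lmult dg (Poly_Mapping.single M 1) (\<theta> (Poly_Mapping.single N 1)))"
    and "p \<in> Lam_deg B dg m" "q \<in> Lam B dg"
  shows "\<theta> (lmult dg p q) = lmult dg (\<theta> p) q + ksign (k * m) (lmult dg p (\<theta> q))"
proof -
  have z: "\<theta> 0 = 0" using assms(2)[of 0 0] by simp
  show ?thesis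
    using assms(4) unfolding Lam_deg_eq_lspan
  proof (induction p rule: lspan_induct)
    case (single M a)
    then have M: "M \<in> lmonos B dg" "m = int (mdeg dg M)" by auto
    from assms(5) show ?case
      unfolding Lam_eq_lspan
    proof (induction q rule: lspan_induct)
      case (single N b)
      let ?M = "Poly_Mapping.single M (1 :: rat)" and ?N = "Poly_Mapping.single N (1 :: rat)"
      have L: "?M \<in> Lam B dg" "?N \<in> Lam B dg" 
        using M single by (auto simp: Lam_eq_lspan intro: single_in_lspan)
      have e: "Poly_Mapping.single M a = lscale a ?M" "Poly_Mapping.single N b = lscale b ?N"
        by simp_all
      show ?case
        unfolding e lmult_lscale_left lmult_lscale_right
        using mono[OF M(1) single] assms(2)[OF L(1)] assms(2)[OF L(2)] assms(2)[OF lmult_in_Lam[OF L]] M(2)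
        by (simp del: lscale_single
            add: lmult_lscale_left lmult_lscale_right lscale_add ksign_eq_lscale mult_ac)
    next
      case (add q q')
      have "Poly_Mapping.single M a \<in> Lam B dg"
        using M by (auto simp: Lam_eq_lspan intro: single_in_lspan)
      then show ?case
        using add lmult_in_Lam[of "Poly_Mapping.single M a" B dg q]
          lmult_in_Lam[of "Poly_Mapping.single M a" B dg q']
        by (simp add: assms(1) Lam_eq_lspan[symmetric] lmult_add_right ksign_eq_lscale lscale_add)
    qed (simp add: z ksign_eq_lscale)
  next
    case (add p p')
    then have "p \<in> Lam B dg" "p' \<in> Lam B dg"
      unfolding Lam_deg_eq_lspan[symmetric] by (auto simp: Lam_deg_subset_Lam)
    then show ?case
      using add.IH lmult_in_Lam[of p B dg q] lmult_in_Lam[of p' B dg q] assms(5)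
      by (simp add: assms(1) lmult_add_left ksign_eq_lscale lscale_add)
  qed (simp add: z ksign_eq_lscale)
qed

text \<open>The value 0 off the carrier is the normal form demanded by \<open>Der\<close>; it makes
  equality of derivations equality of functions.\<close>

definition lin_ext :: "'v set \<Rightarrow> ('v \<Rightarrow> nat) \<Rightarrow> ('v multiset \<Rightarrow> 'v lam) \<Rightarrow> 'v lam \<Rightarrow> 'v lam" where
  "lin_ext B dg t p = (if p \<in> Lam B dg then lext t p else 0)"

lemma lin_ext_in_Der:
  assumes "\<And>M. M \<in> lmonos B dg \<Longrightarrow> t M \<in> Lam_deg B dg (int (mdeg dg M) - k)"
    and "\<And>M N. M \<in> lmonos B dg \<Longrightarrow> N \<in> lmonos B dg \<Longrightarrow>
      lext t (lmult dg (Poly_Mapping.single M 1) (Poly_Mapping.single N 1)) =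
      lmult dg (t M) (Poly_Mapping.single N 1) +
      ksign (k * int (mdeg dg M)) (lmult dg (Poly_Mapping.single M 1) (t N))"
  shows "lin_ext B dg t \<in> Der B dg k"
  unfolding Der_def
proof (intro CollectI conjI allI ballI impI)
  show "lin_ext B dg t p \<in> Lam_deg B dg (m - k)" if p: "p \<in> Lam_deg B dg m" for m p
  proof -
    have "t M \<in> Lam_deg B dg (m - k)" if "M \<in> Poly_Mapping.keys p" for M
      using that p assms(1)[of M] by (auto simp: Lam_deg_def Lam_def)
    then show ?thesis
      using p unfolding lin_ext_def Lam_deg_eq_lspan
      by (auto intro!: lext_in_lspan)
  qed
  have add: "lin_ext B dg t (p + q) = lin_ext B dg t p + lin_ext B dg t q"
    if "p \<in> Lam B dg" "q \<in> Lam B dg" for p q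
    using that by (auto simp: lin_ext_def lext_add Lam_eq_lspan add_in_lspan)
  have scale: "lin_ext B dg t (lscale c p) = lscale c (lin_ext B dg t p)" if "p \<in> Lam B dg" for c p
    using that by (auto simp: lin_ext_def lext_lscale Lam_eq_lspan lscale_in_lspan)
  show "lin_ext B dg t (lmult dg p q) =
      lmult dg (lin_ext B dg t p) q + ksign (k * m) (lmult dg p (lin_ext B dg t q))"
    if "p \<in> Lam_deg B dg m" "q \<in> Lam B dg" for m p q
  proof (rule Der_leibniz_linearI[OF add scale _ that])
    fix M N assume MN: "M \<in> lmonos B dg" "N \<in> lmonos B dg"
    then have *: "Poly_Mapping.single M 1 \<in> Lam B dg" "Poly_Mapping.single N 1 \<in> Lam B dg"
      by (auto simp: Lam_eq_lspan intro: single_in_lspan)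
    then have "lmult dg (Poly_Mapping.single M 1) (Poly_Mapping.single N 1) \<in> Lam B dg"
      by (rule lmult_in_Lam)
    with * show "lin_ext B dg t (lmult dg (Poly_Mapping.single M 1) (Poly_Mapping.single N 1)) =
      lmult dg (lin_ext B dg t (Poly_Mapping.single M 1)) (Poly_Mapping.single N 1) +
      ksign (k * int (mdeg dg M))
        (lmult dg (Poly_Mapping.single M 1) (lin_ext B dg t (Poly_Mapping.single N 1)))"
      using assms(2)[OF MN] by (simp add: lin_ext_def)
  qed
  show "lin_ext B dg t (p + q) = lin_ext B dg t p + lin_ext B dg t q"
    if "p \<in> Lam B dg" "q \<in> Lam B dg" for p q by (rule add[OF that])
  show "lin_ext B dg t (lscale c p) = lscale c (lin_ext B dg t p)" if "p \<in> Lam B dg" for c p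
    by (rule scale[OF that])
qed (simp add: lin_ext_def)

text \<open>The coefficient of the left partial derivative. An odd \<open>x\<close> is first moved
  to the front of the ordered monomial, past the smaller odd generators; an even \<open>x\<close>
  contributes its multiplicity.\<close>

definition partial_coeff :: "('v::linorder \<Rightarrow> nat) \<Rightarrow> 'v \<Rightarrow> 'v multiset \<Rightarrow> rat" where
  "partial_coeff dg x M =
    (if x \<notin># M then 0
     else if odd (dg x) then (- 1) ^ inversions {x} (odds dg (M - {#x#}))
     else of_nat (count M x))"

definition partial :: "('v::linorder \<Rightarrow> nat) \<Rightarrow> 'v \<Rightarrow> 'v multiset \<Rightarrow> 'v lam" where
  "partial dg x M = Poly_Mapping.single (M - {#x#}) (partial_coeff dg x M)"

lemma partial_notin [simp]: "x \<notin># M \<Longrightarrow> partial dg x M = 0"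
  by (simp add: partial_def partial_coeff_def)

lemma partial_odd_add_mset:
  "odd (dg x) \<Longrightarrow> partial dg x (add_mset x M) = Poly_Mapping.single M ((- 1) ^ inversions {x} (odds dg M))"
  by (simp add: partial_def partial_coeff_def)

lemma odds_add_mset: "odds dg (add_mset x M) = (if odd (dg x) then insert x (odds dg M) else odds dg M)"
  by (auto simp: odds_def)

lemma lmonos_odd_remove:
  assumes "M \<in> lmonos B dg" "x \<in># M" "odd (dg x)"
  obtains M' where "M = add_mset x M'" "x \<notin># M'" "M' \<in> lmonos B dg" "x \<notin> odds dg M'"
proof -
  obtain M' where M': "M = add_mset x M'"
    using assms(2) by (metis insert_DiffM)
  then have "{#x#} + M' \<in> lmonos B dg" using assms by simp
  then have "M' \<in> lmonos B dg" "x \<notin> odds dg M'"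
    unfolding add_in_lmonos_iff using assms(3) by auto
  moreover from this have "x \<notin># M'" using assms(3) by (auto simp: odds_def)
  ultimately show thesis using that M' by blast
qed

lemma minus_one_power_cancel: "(- 1 :: rat) ^ a * ((- 1) ^ a * c) = c"
  by (metis mult.assoc mult.left_neutral power_mult_distrib minus_one_mult_self)

text \<open>The Leibniz rule for a partial derivative on monomials, checked according to where
  \<open>x\<close> occurs.\<close>

lemma partial_leibniz:
  assumes M: "M \<in> lmonos B dg" and N: "N \<in> lmonos B dg"
  shows "lscale (mono_sign dg M N) (partial dg x (M + N)) =
    lmult dg (partial dg x M) (Poly_Mapping.single N 1) +
    ksign (int (dg x) * int (mdeg dg M)) (lmult dg (Poly_Mapping.single M 1) (partial dg x N))"
proof (cases "odd (dg x)")
  case False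
  \<comment> \<open>Removing an even generator changes no odd set, so all signs agree and only the
    additivity of multiplicities is left.\<close>
  have o: "odds dg (K - {#x#}) = odds dg K" for K
    using False by (auto simp: odds_def in_diff_count dest: in_diffD)
  have s: "mono_sign dg (M - {#x#}) N = mono_sign dg M N" "mono_sign dg M (N - {#x#}) = mono_sign dg M N"
    by (simp_all add: mono_sign_eq o)
  have "M - {#x#} + N = M + N - {#x#}" if "x \<in># M" using that by simp
  moreover have "M + (N - {#x#}) = M + N - {#x#}" if "x \<in># N" using that by simp
  ultimately show ?thesis
    using False
    by (cases "x \<in># M"; cases "x \<in># N")
      (simp_all add: partial_def partial_coeff_def lmult_single_single s ksign_def not_in_iff
        single_add[symmetric] algebra_simps)
next
  case odd: True
  have ks: "ksign (int (dg x) * int (mdeg dg K)) q = lscale (psign (int (mdeg dg K))) q" for K q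
    using odd by (simp add: ksign_eq_lscale psign_def)
  have par: "psign (int (mdeg dg K)) = (- 1) ^ card (odds dg K)" if "K \<in> lmonos B dg" for K
    using even_mdeg[OF that] by (simp add: psign_def minus_one_power_iff)
  show ?thesis
  proof (cases "x \<in># M")
    case True
    from lmonos_odd_remove[OF M this odd] obtain M' where
      M': "M = add_mset x M'" "x \<notin># M'" "M' \<in> lmonos B dg" "x \<notin> odds dg M'" by metis
    show ?thesis
    proof (cases "x \<in># N")
      case True
      from lmonos_odd_remove[OF N this odd] obtain N' where
        N': "N = add_mset x N'" "x \<notin># N'" "N' \<in> lmonos B dg" "x \<notin> odds dg N'" by metis
      \<comment> \<open>The odd \<open>x\<close> occurs in both factors, so the product is zero and
        the two terms on the right must cancel. Moving \<open>x\<close> through \<open>M'\<close>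
        accounts for the signs in \<open>3\<close>; the occurrence of \<open>x\<close> in
        \<open>M\<close> gives the extra minus sign in \<open>4\<close>.\<close>
      have 0: "mono_sign dg M N = 0"
        using M'(1) N'(1) odd by (auto simp: mono_sign_eq odds_add_mset)
      have 1: "mono_sign dg M' N = (if odds dg M' \<inter> odds dg N' = {} then
          (- 1) ^ (inversions (odds dg M') {x} + inversions (odds dg M') (odds dg N')) else 0)"
        using M' N' odd inversions_Un_right[of "odds dg M'" "{x}" "odds dg N'"]
        by (simp add: mono_sign_eq odds_add_mset)
      have 2: "mono_sign dg M N' = (if odds dg M' \<inter> odds dg N' = {} then
          (- 1) ^ (inversions {x} (odds dg N') + inversions (odds dg M') (odds dg N')) else 0)"
        using M' N' odd inversions_Un_left[of "{x}" "odds dg M'" "odds dg N'"]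
        by (simp add: mono_sign_eq odds_add_mset)
      have "inversions {x} (odds dg M') + inversions (odds dg M') {x} = card (odds dg M')"
        using inversions_swap[of "{x}" "odds dg M'"] M' by simp
      then have 3: "(- 1 :: rat) ^ card (odds dg M') =
          (- 1) ^ inversions {x} (odds dg M') * (- 1) ^ inversions (odds dg M') {x}"
        by (metis power_add)
      have "card (odds dg M) = Suc (card (odds dg M'))"
        using M' odd by (simp add: odds_add_mset)
      then have 4: "psign (int (mdeg dg M)) = - ((- 1) ^ card (odds dg M'))"
        using par[OF M] by simp
      show ?thesis
        unfolding 0 ks 4 using M'(1) N'(1)
        using 1[unfolded N'(1)] 2[unfolded M'(1)]
        by (simp add: partial_odd_add_mset odd lmult_single_single 3 power_add mult_ac
            single_add[symmetric] minus_one_power_cancel flip: single_uminus)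
    next
      case False
      then have xN: "x \<notin> odds dg N" by (auto simp: odds_def)
      have 1: "mono_sign dg M N = (- 1) ^ inversions {x} (odds dg N) * mono_sign dg M' N"
        using M' xN odd inversions_Un_left[of "{x}" "odds dg M'" "odds dg N"]
        by (simp add: mono_sign_eq odds_add_mset power_add)
      have 2: "(- 1) ^ inversions {x} (odds dg N) * (mono_sign dg M' N *
          (- 1) ^ inversions {x} (odds dg M' \<union> odds dg N)) =
          mono_sign dg M' N * (- 1) ^ inversions {x} (odds dg M')"
        using inversions_Un_right[of "{x}" "odds dg M'" "odds dg N"]
        by (auto simp: mono_sign_eq power_add)
      show ?thesis
        using 2 unfolding 1 using False M'(1)
        by (auto simp: partial_odd_add_mset odd lmult_single_single ksign_eq_lscale mult_ac)
    qed
  next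
    case False
    then have xM: "x \<notin> odds dg M" by (auto simp: odds_def)
    show ?thesis
    proof (cases "x \<in># N")
      case True
      from lmonos_odd_remove[OF N this odd] obtain N' where
        N': "N = add_mset x N'" "x \<notin># N'" "N' \<in> lmonos B dg" "x \<notin> odds dg N'" by metis
      have 1: "mono_sign dg M N = (- 1) ^ inversions (odds dg M) {x} * mono_sign dg M N'"
        using N' xM odd inversions_Un_right[of "odds dg M" "{x}" "odds dg N'"]
        by (simp add: mono_sign_eq odds_add_mset power_add)
      have 2: "mono_sign dg M N' * (- 1) ^ inversions {x} (odds dg M \<union> odds dg N') =
          mono_sign dg M N' * ((- 1) ^ inversions {x} (odds dg M) * (- 1) ^ inversions {x} (odds dg N'))"
        using inversions_Un_right[of "{x}" "odds dg M" "odds dg N'"]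
        by (auto simp: mono_sign_eq power_add)
      have "inversions {x} (odds dg M) + inversions (odds dg M) {x} = card (odds dg M)"
        using inversions_swap[of "{x}" "odds dg M"] xM by simp
      then have 3: "psign (int (mdeg dg M)) =
          (- 1) ^ inversions {x} (odds dg M) * (- 1) ^ inversions (odds dg M) {x}"
        unfolding par[OF M] by (metis power_add)
      show ?thesis
        using 2 unfolding 1 ks 3 using False N'(1)
        by (auto simp: partial_odd_add_mset odd lmult_single_single mult_ac)
    qed (use False in \<open>simp add: ksign_eq_lscale\<close>)
  qed
qed

text \<open>Freeness of the algebra: the witness is the sum over \<open>x\<close> of
  \<open>u x\<close> times the partial derivative along \<open>x\<close>. The latter lowers degree
  by \<open>dg x\<close>; commuting \<open>u x\<close>, of degree \<open>dg x - k\<close>, past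
  \<open>M\<close> turns its Leibniz sign into the one for degree \<open>k\<close>.\<close>

lemma Der_exists:
  assumes "\<And>x. x \<in> B \<Longrightarrow> u x \<in> Lam_deg B dg (int (dg x) - k)"
  obtains \<theta> where "\<theta> \<in> Der B dg k" "\<And>x. x \<in> B \<Longrightarrow> \<theta> (gen x) = u x"
proof
  let ?t = "\<lambda>M. \<Sum>x\<in>set_mset M. lmult dg (u x) (partial dg x M)"
  \<comment> \<open>One common index set makes the sums for \<open>M\<close> and for
    \<open>N\<close> comparable with the one for \<open>M + N\<close>.\<close>
  have t: "?t M = (\<Sum>x\<in>S. lmult dg (u x) (partial dg x M))" if "finite S" "set_mset M \<subseteq> S" for M S
    using that by (intro sum.mono_neutral_left) auto
  have deg: "partial dg x M \<in> Lam_deg B dg (int (mdeg dg M) - int (dg x))"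
    if "M \<in> lmonos B dg" "x \<in># M" for x M
  proof -
    from that(2) obtain M' where M': "M = add_mset x M'" by (metis insert_DiffM)
    then have "{#x#} + M' \<in> lmonos B dg" using that(1) by simp
    then have "M' \<in> lmonos B dg" unfolding add_in_lmonos_iff by auto
    with M' show ?thesis
      unfolding partial_def Lam_deg_eq_lspan by (intro single_in_lspan) simp
  qed
  show "lin_ext B dg ?t \<in> Der B dg k"
  proof (rule lin_ext_in_Der)
    fix M assume M: "M \<in> lmonos B dg"
    show "?t M \<in> Lam_deg B dg (int (mdeg dg M) - k)"
      unfolding Lam_deg_eq_lspan
    proof (rule sum_in_lspan, unfold Lam_deg_eq_lspan[symmetric])
      fix x assume x: "x \<in># M"
      with M have "x \<in> B" by (auto simp: lmonos_def)
      from lmult_in_Lam_deg[OF assms[OF this] deg[OF M x]]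
      show "lmult dg (u x) (partial dg x M) \<in> Lam_deg B dg (int (mdeg dg M) - k)"
        by (simp add: algebra_simps)
    qed
  next
    fix M N assume M: "M \<in> lmonos B dg" and N: "N \<in> lmonos B dg"
    let ?M = "Poly_Mapping.single M (1 :: rat)" and ?N = "Poly_Mapping.single N (1 :: rat)"
    let ?S = "set_mset M \<union> set_mset N"
    have MD: "?M \<in> Lam_deg B dg (int (mdeg dg M))"
      unfolding Lam_deg_eq_lspan using M by (intro single_in_lspan) simp
    have "lext ?t (lmult dg ?M ?N) = (\<Sum>x\<in>?S. lmult dg (u x) (lscale (mono_sign dg M N) (partial dg x (M + N))))"
      by (simp add: lmult_single_single lscale_sum lmult_lscale_right)
    also have "\<dots> = (\<Sum>x\<in>?S. lmult dg (lmult dg (u x) (partial dg x M)) ?N +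
        ksign (k * int (mdeg dg M)) (lmult dg ?M (lmult dg (u x) (partial dg x N))))"
    proof (rule sum.cong[OF refl])
      fix x assume "x \<in> ?S"
      with M N have "x \<in> B" by (auto simp: lmonos_def)
      from lmult_commute[OF assms[OF this] MD] have
        c: "lmult dg (u x) ?M = ksign ((int (dg x) - k) * int (mdeg dg M)) (lmult dg ?M (u x))" .
      have p: "psign (int (dg x) * int (mdeg dg M)) * psign ((int (dg x) - k) * int (mdeg dg M)) =
          psign (k * int (mdeg dg M))"
        by (simp add: psign_def)
      show "lmult dg (u x) (lscale (mono_sign dg M N) (partial dg x (M + N))) =
          lmult dg (lmult dg (u x) (partial dg x M)) ?N +
          ksign (k * int (mdeg dg M)) (lmult dg ?M (lmult dg (u x) (partial dg x N)))"
        unfolding partial_leibniz[OF M N] lmult_add_right lmult_ksign_right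
          lmult_assoc[symmetric] c
        by (simp add: ksign_eq_lscale lmult_lscale_left p)
    qed
    also have "\<dots> = lmult dg (?t M) ?N + ksign (k * int (mdeg dg M)) (lmult dg ?M (?t N))"
      by (simp add: t[of ?S] sum.distrib lmult_sum_left lmult_sum_right ksign_eq_lscale lscale_sum)
    finally show "lext ?t (lmult dg ?M ?N) =
        lmult dg (?t M) ?N + ksign (k * int (mdeg dg M)) (lmult dg ?M (?t N))" .
  qed
  show "lin_ext B dg ?t (gen x) = u x" if "x \<in> B" for x
  proof -
    have "partial dg x {#x#} = Poly_Mapping.single {#} 1"
      by (simp add: partial_def partial_coeff_def inversions_def)
    moreover have "gen x \<in> Lam B dg"
      using that by (simp add: gen_def Lam_eq_lspan single_in_lspan)
    ultimately show ?thesis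
      by (simp add: lin_ext_def gen_def)
  qed
qed

section \<open>Derivations are determined on generators\<close>

lemma gen_in_Lam_deg: "x \<in> B \<Longrightarrow> gen x \<in> Lam_deg B dg (int (dg x))"
  unfolding gen_def Lam_deg_eq_lspan by (rule single_in_lspan) simp

lemma gen_in_Lam: "x \<in> B \<Longrightarrow> gen x \<in> Lam B dg"
  by (rule Lam_deg_subset_Lam[OF gen_in_Lam_deg])

lemma single_in_Lam_deg: "M \<in> lmonos B dg \<Longrightarrow> Poly_Mapping.single M c \<in> Lam_deg B dg (int (mdeg dg M))"
  unfolding Lam_deg_eq_lspan by (rule single_in_lspan) simp

lemma single_in_Lam: "M \<in> lmonos B dg \<Longrightarrow> Poly_Mapping.single M c \<in> Lam B dg"
  by (rule Lam_deg_subset_Lam[OF single_in_Lam_deg])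

lemma Der_one: "\<theta> \<in> Der B dg k \<Longrightarrow> \<theta> 1 = 0"
  using Der_leibniz[of \<theta> B dg k 1 0 1] single_in_Lam_deg[of "{#}" B dg 1] single_in_Lam[of "{#}" B dg 1]
  by (simp add: ksign_def)

lemma lmonos_add_mset:
  assumes "add_mset x M \<in> lmonos B dg"
  shows "x \<in> B" "M \<in> lmonos B dg" "mono_sign dg {#x#} M \<noteq> 0"
proof -
  have "{#x#} + M \<in> lmonos B dg" using assms by simp
  then show "x \<in> B" "M \<in> lmonos B dg" "mono_sign dg {#x#} M \<noteq> 0"
    unfolding add_in_lmonos_iff mono_sign_nonzero_iff by auto
qed

text \<open>The product has \<open>x\<close> in front, the basis monomial has it in sorted position.
  The sign between them is invertible because the monomial is admissible.\<close>

lemma single_add_mset: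
  assumes "add_mset x M \<in> lmonos B dg"
  shows "Poly_Mapping.single (add_mset x M) 1 =
    lscale (1 / mono_sign dg {#x#} M) (lmult dg (gen x) (Poly_Mapping.single M 1))"
  using lmonos_add_mset(3)[OF assms] by (simp add: gen_def lmult_single_single)

lemma Der_single_add_mset:
  assumes "\<theta> \<in> Der B dg k" "add_mset x M \<in> lmonos B dg"
  shows "\<theta> (Poly_Mapping.single (add_mset x M) 1) =
    lscale (1 / mono_sign dg {#x#} M) (lmult dg (\<theta> (gen x)) (Poly_Mapping.single M 1) +
      ksign (k * int (dg x)) (lmult dg (gen x) (\<theta> (Poly_Mapping.single M 1))))"
proof -
  note * = lmonos_add_mset[OF assms(2)]
  show ?thesis
    unfolding single_add_mset[OF assms(2)]
    using Der_lscale[OF assms(1) lmult_in_Lam[OF gen_in_Lam[OF *(1)] single_in_Lam[OF *(2)]]]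
      Der_leibniz[OF assms(1) gen_in_Lam_deg[OF *(1)] single_in_Lam[OF *(2)]]
    by simp
qed

text \<open>Only the generators occurring in \<open>p\<close> are tested. This locality allows a
  derivation to be altered on other generators, and lets degree arguments kill it on
  decomposables.\<close>

lemma Der_eq_0:
  assumes "\<theta> \<in> Der B dg k" "p \<in> Lam B dg"
    and "\<And>M x. M \<in> Poly_Mapping.keys p \<Longrightarrow> x \<in># M \<Longrightarrow> \<theta> (gen x) = 0"
  shows "\<theta> p = 0"
proof -
  have *: "\<theta> (Poly_Mapping.single M 1) = 0" if "M \<in> lmonos B dg" "\<And>x. x \<in># M \<Longrightarrow> \<theta> (gen x) = 0" for M
    using that
  proof (induction M)
    case empty
    show ?case using Der_one[OF assms(1)] by simp
  next
    case (add x M)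
    then show ?case
      using lmonos_add_mset[OF add.prems(1)]
      by (simp add: Der_single_add_mset[OF assms(1)] ksign_eq_lscale)
  qed
  have "lext (\<lambda>M. \<theta> (Poly_Mapping.single M 1)) p = lext (\<lambda>M. 0) p"
    using assms(2,3) by (intro lext_cong *) (auto simp: Lam_def)
  then show ?thesis
    by (simp add: Der_eq_lext[OF assms(1,2)] lext_zero_fun)
qed

lemma Der_diff_in_Der:
  assumes "\<theta> \<in> Der B dg k" "\<eta> \<in> Der B dg k"
  shows "\<theta> - \<eta> \<in> Der B dg k"
  unfolding Der_def
proof (intro CollectI conjI allI ballI impI)
  show "(\<theta> - \<eta>) p \<in> Lam_deg B dg (m - k)" if "p \<in> Lam_deg B dg m" for m p
    using assms[THEN Der_deg, OF that] by (simp add: Lam_deg_eq_lspan diff_in_lspan)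
  show "(\<theta> - \<eta>) (lmult dg p q) = lmult dg ((\<theta> - \<eta>) p) q + ksign (k * m) (lmult dg p ((\<theta> - \<eta>) q))"
    if "p \<in> Lam_deg B dg m" "q \<in> Lam B dg" for m p q
    using assms[THEN Der_leibniz, OF that]
    by (simp add: lmult_diff_left lmult_diff_right ksign_eq_lscale lscale_diff)
qed (use assms in \<open>auto simp: Der_outside Der_add Der_lscale lscale_diff\<close>)

lemma Der_eqI:
  assumes "\<theta> \<in> Der B dg k" "\<eta> \<in> Der B dg k" "p \<in> Lam B dg"
    and "\<And>M x. M \<in> Poly_Mapping.keys p \<Longrightarrow> x \<in># M \<Longrightarrow> \<theta> (gen x) = \<eta> (gen x)"
  shows "\<theta> p = \<eta> p"
  using Der_eq_0[OF Der_diff_in_Der[OF assms(1,2)] assms(3)] assms(4) by simp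

section \<open>Brackets, squares and the module structure of derivations\<close>

lemma ksign_apply: "ksign k f x = ksign k (f x)"
  by (simp add: ksign_def)

lemma Der_bracket:
  assumes "\<theta> \<in> Der B dg i" "\<eta> \<in> Der B dg j"
  shows "(\<theta> \<circ> \<eta>) - ksign (i * j) (\<eta> \<circ> \<theta>) \<in> Der B dg (i + j)"
  unfolding Der_def
proof (intro CollectI conjI allI ballI impI)
  note lin = Der_zero Der_add Der_lscale Der_Lam
  show "((\<theta> \<circ> \<eta>) - ksign (i * j) (\<eta> \<circ> \<theta>)) p \<in> Lam_deg B dg (m - (i + j))"
    if "p \<in> Lam_deg B dg m" for m p
  proof -
    have "\<theta> (\<eta> p) \<in> Lam_deg B dg (m - (i + j))" "\<eta> (\<theta> p) \<in> Lam_deg B dg (m - (i + j))"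
      using Der_deg[OF assms(1) Der_deg[OF assms(2) that]] Der_deg[OF assms(2) Der_deg[OF assms(1) that]]
      by (simp_all add: algebra_simps)
    then show ?thesis
      by (simp add: ksign_apply Lam_deg_eq_lspan diff_in_lspan ksign_in_lspan)
  qed
  show "((\<theta> \<circ> \<eta>) - ksign (i * j) (\<eta> \<circ> \<theta>)) (lmult dg p q) =
      lmult dg (((\<theta> \<circ> \<eta>) - ksign (i * j) (\<eta> \<circ> \<theta>)) p) q +
      ksign ((i + j) * m) (lmult dg p (((\<theta> \<circ> \<eta>) - ksign (i * j) (\<eta> \<circ> \<theta>)) q))"
    if p: "p \<in> Lam_deg B dg m" and q: "q \<in> Lam B dg" for m p q
  proof -
    have pL: "p \<in> Lam B dg" using p by (rule Lam_deg_subset_Lam)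
    \<comment> \<open>The composite obeys the Leibniz rule up to two mixed terms. Exchanging
      \<alpha> and \<beta> swaps these up to the sign of the graded commutator, where they
      cancel.\<close>
    have comp: "\<alpha> (\<beta> (lmult dg p q)) = lmult dg (\<alpha> (\<beta> p)) q
        + lscale (psign (a * m) * psign (a * b)) (lmult dg (\<beta> p) (\<alpha> q))
        + lscale (psign (b * m)) (lmult dg (\<alpha> p) (\<beta> q))
        + lscale (psign (a * m) * psign (b * m)) (lmult dg p (\<alpha> (\<beta> q)))"
      if \<alpha>: "\<alpha> \<in> Der B dg a" and \<beta>: "\<beta> \<in> Der B dg b" for \<alpha> \<beta> a b
    proof -
      note \<beta>p = Der_deg[OF \<beta> p] and \<beta>q = Der_Lam[OF \<beta> q]
      have "\<alpha> (\<beta> (lmult dg p q)) =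
          \<alpha> (lmult dg (\<beta> p) q) + lscale (psign (b * m)) (\<alpha> (lmult dg p (\<beta> q)))"
      proof -
        have "lmult dg (\<beta> p) q \<in> Lam B dg" "lmult dg p (\<beta> q) \<in> Lam B dg"
          using Der_Lam[OF \<beta> pL] \<beta>q pL q by (simp_all add: lmult_in_Lam)
        moreover from this have "lscale (psign (b * m)) (lmult dg p (\<beta> q)) \<in> Lam B dg"
          by (simp add: Lam_eq_lspan lscale_in_lspan)
        ultimately show ?thesis
          unfolding Der_leibniz[OF \<beta> p q] ksign_eq_lscale
          by (simp add: Der_add[OF \<alpha>] Der_lscale[OF \<alpha>])
      qed
      also have "\<dots> = lmult dg (\<alpha> (\<beta> p)) q
        + lscale (psign (a * m) * psign (a * b)) (lmult dg (\<beta> p) (\<alpha> q))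
        + lscale (psign (b * m)) (lmult dg (\<alpha> p) (\<beta> q))
        + lscale (psign (a * m) * psign (b * m)) (lmult dg p (\<alpha> (\<beta> q)))"
        unfolding Der_leibniz[OF \<alpha> \<beta>p q] Der_leibniz[OF \<alpha> p \<beta>q]
        by (simp add: ksign_eq_lscale lscale_add right_diff_distrib psign_diff mult_ac)
      finally show ?thesis .
    qed
    have s: "psign ((i + j) * m) = psign (i * m) * psign (j * m)"
      by (simp add: distrib_right psign_add)
    have u: "psign k * (psign k * c) = c" for k c
      by (simp add: psign_def)
    show ?thesis
      unfolding ksign_eq_lscale s
      by (simp add: ksign_apply comp[OF assms] comp[OF assms(2,1)] ksign_eq_lscale lscale_add lscale_diff
          lmult_add_left lmult_diff_left lmult_lscale_left lmult_add_right lmult_diff_right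
          lmult_lscale_right mult_ac u)
  qed
  show "((\<theta> \<circ> \<eta>) - ksign (i * j) (\<eta> \<circ> \<theta>)) p = 0" if "p \<notin> Lam B dg" for p
    using that assms by (simp add: Der_outside Der_zero ksign_apply ksign_eq_lscale)
  show "((\<theta> \<circ> \<eta>) - ksign (i * j) (\<eta> \<circ> \<theta>)) (p + q) =
      ((\<theta> \<circ> \<eta>) - ksign (i * j) (\<eta> \<circ> \<theta>)) p + ((\<theta> \<circ> \<eta>) - ksign (i * j) (\<eta> \<circ> \<theta>)) q"
    if "p \<in> Lam B dg" "q \<in> Lam B dg" for p q
    using that assms by (simp add: ksign_apply ksign_eq_lscale lscale_add Der_add Der_Lam)
  show "((\<theta> \<circ> \<eta>) - ksign (i * j) (\<eta> \<circ> \<theta>)) (lscale c p) =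
      lscale c (((\<theta> \<circ> \<eta>) - ksign (i * j) (\<eta> \<circ> \<theta>)) p)"
    if "p \<in> Lam B dg" for c p
    using that assms by (simp add: ksign_apply ksign_eq_lscale lscale_diff Der_lscale Der_Lam mult.commute)
qed

lemma lscale_two: "lscale 2 p = p + p"
  by (rule poly_mapping_eqI) (simp only: lookup_lscale lookup_add mult_2)

text \<open>The square of an odd derivation is half its graded commutator with itself, hence up to a
  scalar a derivation, to which the test on generators applies.\<close>

lemma Der_square:
  assumes "\<theta> \<in> Der B dg k" "odd k" "p \<in> Lam B dg"
    and "\<And>M x. M \<in> Poly_Mapping.keys p \<Longrightarrow> x \<in># M \<Longrightarrow> \<theta> (\<theta> (gen x)) = 0"
  shows "\<theta> (\<theta> p) = 0"
proof -
  have *: "((\<theta> \<circ> \<theta>) - ksign (k * k) (\<theta> \<circ> \<theta>)) q = lscale 2 (\<theta> (\<theta> q))" for q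
    using \<open>odd k\<close> by (simp add: ksign_def lscale_two)
  have "lscale 2 (\<theta> (\<theta> p)) = 0"
    using Der_eq_0[OF Der_bracket[OF assms(1,1)] assms(3)] assms(4) unfolding * by simp
  then show ?thesis by (simp add: lscale_eq_0_iff)
qed

text \<open>The module structure of the derivations over the algebra. Commuting \<open>a\<close>
  past \<open>p\<close> changes the Leibniz sign from exponent \<open>k * m\<close> to
  \<open>(k - l) * m\<close>.\<close>

lemma lmult_Der_in_Der:
  assumes "\<theta> \<in> Der B dg k" "a \<in> Lam_deg B dg l"
  shows "(\<lambda>p. lmult dg a (\<theta> p)) \<in> Der B dg (k - l)"
  unfolding Der_def
proof (intro CollectI conjI allI ballI impI)
  show "lmult dg a (\<theta> p) \<in> Lam_deg B dg (m - (k - l))" if "p \<in> Lam_deg B dg m" for m p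
    using lmult_in_Lam_deg[OF assms(2) Der_deg[OF assms(1) that]] by (simp add: algebra_simps)
  show "lmult dg a (\<theta> (lmult dg p q)) =
      lmult dg (lmult dg a (\<theta> p)) q + ksign ((k - l) * m) (lmult dg p (lmult dg a (\<theta> q)))"
    if "p \<in> Lam_deg B dg m" "q \<in> Lam B dg" for m p q
    unfolding Der_leibniz[OF assms(1) that] lmult_add_right lmult_ksign_right
      lmult_assoc[symmetric] lmult_commute[OF assms(2) that(1)]
    by (simp add: lmult_ksign_left lmult_lscale_left ksign_eq_lscale left_diff_distrib psign_diff)
qed (use assms in \<open>auto simp: Der_outside Der_add Der_lscale lmult_add_right lmult_lscale_right\<close>)

definition weight :: "('v \<Rightarrow> int) \<Rightarrow> 'v multiset \<Rightarrow> int" where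
  "weight \<omega> M = (\<Sum>x\<in>#M. \<omega> x)"

lemma weight_simps [simp]:
  "weight \<omega> {#} = 0" "weight \<omega> (add_mset x M) = \<omega> x + weight \<omega> M"
  "weight \<omega> (M + N) = weight \<omega> M + weight \<omega> N"
  by (simp_all add: weight_def)

text \<open>A multiplicative decreasing filtration. Constant weight 1 bounds the word length from
  below, constant weight -1 bounds it from above, and a 0-1 weight counts factors of one
  kind.\<close>

definition Fil :: "'v set \<Rightarrow> ('v \<Rightarrow> nat) \<Rightarrow> ('v \<Rightarrow> int) \<Rightarrow> int \<Rightarrow> 'v lam set" where
  "Fil B dg \<omega> i = lspan {M \<in> lmonos B dg. i \<le> weight \<omega> M}"

lemma lmult_in_Fil: "p \<in> Fil B dg \<omega> i \<Longrightarrow> q \<in> Fil B dg \<omega> j \<Longrightarrow> lmult dg p q \<in> Fil B dg \<omega> (i + j)"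
  unfolding Fil_def by (erule (1) lmult_in_lspan) (simp add: add_in_lmonos_iff)

lemma Fil_subset_Lam: "p \<in> Fil B dg \<omega> i \<Longrightarrow> p \<in> Lam B dg"
  unfolding Fil_def Lam_eq_lspan lspan_def by auto

lemma Fil_mono: "i \<le> j \<Longrightarrow> Fil B dg \<omega> j \<subseteq> Fil B dg \<omega> i"
  unfolding Fil_def by (rule lspan_mono) auto

lemma single_in_Fil: "M \<in> lmonos B dg \<Longrightarrow> i \<le> weight \<omega> M \<Longrightarrow> Poly_Mapping.single M c \<in> Fil B dg \<omega> i"
  unfolding Fil_def by (rule single_in_lspan) simp

lemma gen_in_Fil: "x \<in> B \<Longrightarrow> i \<le> \<omega> x \<Longrightarrow> gen x \<in> Fil B dg \<omega> i"
  unfolding gen_def by (rule single_in_Fil) auto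

lemma Der_Fil:
  assumes "\<theta> \<in> Der B dg k" "\<And>x. x \<in> B \<Longrightarrow> \<theta> (gen x) \<in> Fil B dg \<omega> (\<omega> x + c)"
    and "p \<in> Fil B dg \<omega> i"
  shows "\<theta> p \<in> Fil B dg \<omega> (i + c)"
proof -
  have *: "\<theta> (Poly_Mapping.single M 1) \<in> Fil B dg \<omega> (weight \<omega> M + c)" if "M \<in> lmonos B dg" for M
    using that
  proof (induction M)
    case empty
    show ?case using Der_one[OF assms(1)] by (simp add: Fil_def)
  next
    case (add x M)
    note xM = lmonos_add_mset[OF add.prems]
    have "lmult dg (\<theta> (gen x)) (Poly_Mapping.single M 1) \<in> Fil B dg \<omega> ((\<omega> x + c) + weight \<omega> M)"
      by (intro lmult_in_Fil assms(2) xM single_in_Fil) simp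
    moreover have "lmult dg (gen x) (\<theta> (Poly_Mapping.single M 1)) \<in> Fil B dg \<omega> (\<omega> x + (weight \<omega> M + c))"
      by (intro lmult_in_Fil add.IH xM gen_in_Fil) simp
    ultimately show ?case
      unfolding Der_single_add_mset[OF assms(1) add.prems] Fil_def
      by (intro lscale_in_lspan add_in_lspan ksign_in_lspan) (simp_all add: algebra_simps)
  qed
  have "\<theta> (Poly_Mapping.single M 1) \<in> Fil B dg \<omega> (i + c)" if "M \<in> Poly_Mapping.keys p" for M
  proof -
    have M: "M \<in> lmonos B dg" "i \<le> weight \<omega> M"
      using that assms(3) by (auto simp: Fil_def lspan_def)
    from M(2) show ?thesis using *[OF M(1)] Fil_mono[of "i + c" "weight \<omega> M + c" B dg \<omega>] by auto
  qed
  then show ?thesis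
    unfolding Der_eq_lext[OF assms(1) Fil_subset_Lam[OF assms(3)]] Fil_def
    by (intro lext_in_lspan)
qed

section \<open>The acyclic closure of a minimal model\<close>

text \<open>The generator \<open>(False, v)\<close> stands for \<open>v\<close> and \<open>(True, v)\<close> for its suspension.  In the
  lexicographic order all suspensions come last, so that no sign arises when a monomial is split
  into its two parts.\<close>

definition cB :: "'v set \<Rightarrow> (bool \<times> 'v) set" where
  "cB B = UNIV \<times> B"

definition cdg :: "('v \<Rightarrow> nat) \<Rightarrow> bool \<times> 'v \<Rightarrow> nat" where
  "cdg dg x = (if fst x then dg (snd x) - 1 else dg (snd x))"

lemma cdg_simps [simp]: "cdg dg (False, v) = dg v" "cdg dg (True, v) = dg v - 1"
  by (simp_all add: cdg_def)

lemma in_cB [simp]: "(b, v) \<in> cB B \<longleftrightarrow> v \<in> B"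
  by (simp add: cB_def)

abbreviation emb_mono :: "'v multiset \<Rightarrow> (bool \<times> 'v) multiset" where
  "emb_mono \<equiv> image_mset (Pair False)"

text \<open>The inclusion of the minimal model into its acyclic closure.\<close>

definition emb :: "'v lam \<Rightarrow> (bool \<times> 'v) lam" where
  "emb = lext (\<lambda>M. Poly_Mapping.single (emb_mono M) 1)"

lemma emb_single [simp]: "emb (Poly_Mapping.single M c) = Poly_Mapping.single (emb_mono M) c"
  and emb_0 [simp]: "emb 0 = 0"
  and emb_add: "emb (p + q) = emb p + emb q"
  and emb_lscale: "emb (lscale c p) = lscale c (emb p)"
  and emb_gen [simp]: "emb (gen x) = gen (False, x)"
  by (simp_all add: emb_def lext_add lext_lscale gen_def)

lemma emb_ksign: "emb (ksign k p) = ksign k (emb p)"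
  by (simp add: ksign_eq_lscale emb_lscale)

lemma odds_emb_mono [simp]: "odds (cdg dg) (emb_mono M) = Pair False ` odds dg M"
  by (auto simp: odds_def)

lemma inversions_emb: "inversions (Pair False ` X) (Pair False ` Y) = inversions X Y"
proof -
  have "{(x, y). x \<in> Pair False ` X \<and> y \<in> Pair False ` Y \<and> y < x} =
      map_prod (Pair False) (Pair False) ` {(x, y). x \<in> X \<and> y \<in> Y \<and> y < x}"
    by (auto simp: image_iff)
  then show ?thesis
    unfolding inversions_def by (simp add: card_image inj_on_def)
qed

lemma mono_sign_emb: "mono_sign (cdg dg) (emb_mono M) (emb_mono N) = mono_sign dg M N"
proof -
  have "Pair False ` X \<inter> Pair False ` Y = {} \<longleftrightarrow> X \<inter> Y = {}" for X Y :: "'a set"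
    by auto
  then show ?thesis by (simp add: mono_sign_eq inversions_emb)
qed

lemma emb_lmult: "emb (lmult dg p q) = lmult (cdg dg) (emb p) (emb q)"
proof -
  have "p \<in> lspan UNIV" "q \<in> lspan UNIV" by (simp_all add: lspan_def)
  from this(1) show ?thesis
  proof (induction p rule: lspan_induct)
    case (single M a)
    from \<open>q \<in> lspan UNIV\<close> show ?case
      by (induction q rule: lspan_induct)
        (simp_all add: lmult_single_single mono_sign_emb lmult_add_right emb_add)
  qed (simp_all add: lmult_add_left emb_add)
qed

lemma count_emb_mono: "count (emb_mono M) (b, v) = (if b then 0 else count M v)"
proof -
  have "count (emb_mono M) (False, v) = count M v"
    by (induction M) auto
  moreover have "(True, v) \<notin># emb_mono M" by auto
  ultimately show ?thesis by (auto simp: not_in_iff)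
qed

lemma emb_mono_lmonos: "M \<in> lmonos B dg \<Longrightarrow> emb_mono M \<in> lmonos (cB B) (cdg dg)"
  by (auto simp: lmonos_def count_emb_mono)

lemma mdeg_emb_mono [simp]: "mdeg (cdg dg) (emb_mono M) = mdeg dg M"
  by (simp add: mdeg_def multiset.map_comp comp_def)

lemma emb_in_lspan: "p \<in> lspan X \<Longrightarrow> emb_mono ` X \<subseteq> Y \<Longrightarrow> emb p \<in> lspan Y"
  unfolding emb_def by (intro lext_in_lspan single_in_lspan) (auto simp: lspan_def)

lemma emb_in_Lam_deg: "p \<in> Lam_deg B dg k \<Longrightarrow> emb p \<in> Lam_deg (cB B) (cdg dg) k"
  unfolding Lam_deg_eq_lspan by (erule emb_in_lspan) (auto simp: emb_mono_lmonos)

text \<open>Both derivations obey the same recursion on monomials, and the inclusion respects the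
  signs in it.\<close>

lemma Der_emb:
  assumes "D \<in> Der (cB B) (cdg dg) k" "d \<in> Der B dg k"
    and "\<And>x. x \<in> B \<Longrightarrow> D (gen (False, x)) = emb (d (gen x))"
    and "p \<in> Lam B dg"
  shows "D (emb p) = emb (d p)"
proof -
  have *: "D (Poly_Mapping.single (emb_mono M) 1) = emb (d (Poly_Mapping.single M 1))"
    if "M \<in> lmonos B dg" for M
    using that
  proof (induction M)
    case empty
    show ?case using Der_one[OF assms(1)] Der_one[OF assms(2)] by simp
  next
    case (add x M)
    note xM = lmonos_add_mset[OF add.prems]
    have W: "add_mset (False, x) (emb_mono M) \<in> lmonos (cB B) (cdg dg)"
      using emb_mono_lmonos[OF add.prems] by simp
    have s: "mono_sign (cdg dg) {#(False, x)#} (emb_mono M) = mono_sign dg {#x#} M"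
      using mono_sign_emb[of dg "{#x#}" M] by simp
    show ?case
      using add.IH[OF xM(2)] assms(3)[OF xM(1)]
      by (simp add: Der_single_add_mset[OF assms(1) W] Der_single_add_mset[OF assms(2) add.prems]
          s emb_lscale emb_add emb_lmult emb_ksign)
  qed
  show ?thesis
    using assms(4) unfolding Lam_eq_lspan
  proof (induction p rule: lspan_induct)
    case (single M c)
    have "D (lscale c (emb (Poly_Mapping.single M 1))) = emb (d (lscale c (Poly_Mapping.single M 1)))"
      using *[OF single] emb_mono_lmonos[OF single] single
      by (simp only: emb_single Der_lscale[OF assms(1)] Der_lscale[OF assms(2)] single_in_Lam emb_lscale)
    then show ?case by simp
  next
    case (add p q)
    then have "p \<in> Lam B dg" "q \<in> Lam B dg" "emb p \<in> Lam (cB B) (cdg dg)" "emb q \<in> Lam (cB B) (cdg dg)"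
      unfolding Lam_eq_lspan by (auto intro!: emb_in_lspan emb_mono_lmonos)
    with add.IH show ?case
      by (simp add: emb_add Der_add[OF assms(1)] Der_add[OF assms(2)])
  qed (simp add: Der_zero[OF assms(1)] Der_zero[OF assms(2)])
qed

section \<open>Homogeneous parts, word length and the two filtrations\<close>

lemma lspan_disjoint:
  assumes "p \<in> lspan X" "p \<in> lspan Y" "X \<inter> Y = {}"
  shows "p = 0"
proof -
  have "p \<in> lspan (X \<inter> Y)" using assms(1,2) by (simp add: lspan_Int)
  then show ?thesis by (simp add: assms(3) lspan_empty)
qed

definition part :: "('v multiset \<Rightarrow> bool) \<Rightarrow> 'v lam \<Rightarrow> 'v lam" where
  "part P = lext (\<lambda>M. if P M then Poly_Mapping.single M 1 else 0)"

lemma lookup_part: "Poly_Mapping.lookup (part P p) M = (if P M then Poly_Mapping.lookup p M else 0)"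
proof -
  have "p \<in> lspan UNIV" by (simp add: lspan_def)
  then show ?thesis
    by (induction p rule: lspan_induct) (auto simp: part_def lext_add lookup_add lookup_single when_def)
qed

lemma part_in_lspan: "p \<in> lspan X \<Longrightarrow> part P p \<in> lspan {M \<in> X. P M}"
  and minus_part_in_lspan: "p \<in> lspan X \<Longrightarrow> p - part P p \<in> lspan {M \<in> X. \<not> P M}"
  by (auto simp: lspan_iff lookup_part lookup_minus split: if_splits)

text \<open>The Euler derivation counts word length: the Leibniz rule adds one copy of the monomial
  for each factor.\<close>

lemma euler_derivation:
  assumes "\<theta> \<in> Der B dg 0" "\<And>x. x \<in> B \<Longrightarrow> \<theta> (gen x) = gen x"
    and "p \<in> lspan {M \<in> lmonos B dg. size M = m}"
  shows "\<theta> p = lscale (of_nat m) p"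
proof -
  have *: "\<theta> (Poly_Mapping.single M 1) = lscale (of_nat (size M)) (Poly_Mapping.single M 1)"
    if "M \<in> lmonos B dg" for M
    using that
  proof (induction M)
    case empty
    show ?case using Der_one[OF assms(1)] by simp
  next
    case (add x M)
    note xM = lmonos_add_mset[OF add.prems]
    let ?M = "Poly_Mapping.single M (1 :: rat)" and ?e = "1 / mono_sign dg {#x#} M"
    have "\<theta> (Poly_Mapping.single (add_mset x M) 1) =
        lscale ?e (lmult dg (gen x) ?M + lmult dg (gen x) (lscale (of_nat (size M)) ?M))"
      unfolding Der_single_add_mset[OF assms(1) add.prems] assms(2)[OF xM(1)] add.IH[OF xM(2)]
      by (simp add: ksign_def)
    also have "\<dots> = lscale (of_nat (size (add_mset x M))) (lscale ?e (lmult dg (gen x) ?M))"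
      by (simp add: lmult_lscale_right lscale_left_add lscale_add add_divide_distrib del: lscale_single)
    finally show ?case
      unfolding single_add_mset[OF add.prems] .
  qed
  have "p \<in> Lam B dg" using assms(3) by (auto simp: Lam_eq_lspan lspan_def)
  then have "\<theta> p = lext (\<lambda>M. lscale (of_nat (size M)) (Poly_Mapping.single M 1)) p"
    unfolding Der_eq_lext[OF assms(1) \<open>p \<in> Lam B dg\<close>] by (intro lext_cong *) (auto simp: Lam_def)
  also have "\<dots> = lext (\<lambda>M. lscale (of_nat m) (Poly_Mapping.single M 1)) p"
    using assms(3) by (intro lext_cong) (auto simp: lspan_def)
  also have "\<dots> = lscale (of_nat m) p"
    using lookup_part[of "\<lambda>_. True" p] unfolding lext_lscale_fun part_def by (simp add: poly_mapping_eq_iff fun_eq_iff)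
  finally show ?thesis .
qed

text \<open>\<open>FilV\<close> counts unsuspended factors: it is the filtration by powers of the
  ideal they generate. \<open>FilS\<close> is the filtration by word length.\<close>

abbreviation FilV :: "'v set \<Rightarrow> ('v \<Rightarrow> nat) \<Rightarrow> int \<Rightarrow> (bool \<times> 'v) lam set" where
  "FilV B dg \<equiv> Fil (cB B) (cdg dg) (\<lambda>x. if fst x then 0 else 1)"

abbreviation FilS :: "'v set \<Rightarrow> ('v \<Rightarrow> nat) \<Rightarrow> int \<Rightarrow> (bool \<times> 'v) lam set" where
  "FilS B dg \<equiv> Fil (cB B) (cdg dg) (\<lambda>x. 1)"

lemma weight_const: "weight (\<lambda>x. c) M = c * int (size M)"
  by (induction M) (auto simp: algebra_simps)

lemma weight_V_pos:
  assumes "1 \<le> weight (\<lambda>x. if fst x then 0 else 1) M"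
  obtains u where "(False, u) \<in># M"
proof -
  have "weight (\<lambda>x. if fst x then 0 else 1) M = 0" if "\<And>u. (False, u) \<notin># M"
    using that
  proof (induction M)
    case (add x M)
    then have "fst x" by (cases x) auto
    with add show ?case by auto
  qed simp
  then show thesis using that assms by force
qed

lemma Fil_add: "p \<in> Fil B dg \<omega> i \<Longrightarrow> q \<in> Fil B dg \<omega> i \<Longrightarrow> p + q \<in> Fil B dg \<omega> i"
  and Fil_diff: "p \<in> Fil B dg \<omega> i \<Longrightarrow> q \<in> Fil B dg \<omega> i \<Longrightarrow> p - q \<in> Fil B dg \<omega> i"
  and Fil_uminus: "p \<in> Fil B dg \<omega> i \<Longrightarrow> - p \<in> Fil B dg \<omega> i"
  and Fil_lscale: "p \<in> Fil B dg \<omega> i \<Longrightarrow> lscale c p \<in> Fil B dg \<omega> i"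
  and Fil_zero [simp]: "0 \<in> Fil B dg \<omega> i"
  by (simp_all add: Fil_def add_in_lspan diff_in_lspan lscale_in_lspan uminus_in_lspan)

lemma Lam_deg_add: "p \<in> Lam_deg B dg i \<Longrightarrow> q \<in> Lam_deg B dg i \<Longrightarrow> p + q \<in> Lam_deg B dg i"
  and Lam_deg_diff: "p \<in> Lam_deg B dg i \<Longrightarrow> q \<in> Lam_deg B dg i \<Longrightarrow> p - q \<in> Lam_deg B dg i"
  and Lam_deg_lscale: "p \<in> Lam_deg B dg i \<Longrightarrow> lscale c p \<in> Lam_deg B dg i"
  and Lam_deg_zero [simp]: "0 \<in> Lam_deg B dg i"
  by (simp_all add: Lam_deg_eq_lspan add_in_lspan diff_in_lspan lscale_in_lspan)

section \<open>Construction of the differential of the acyclic closure\<close>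

locale minimal_model =
  fixes B :: "'v::linorder set" and dg d
  assumes sc_minimal_model: "sc_minimal_model B dg d"
begin

lemma dg_ge_2: "x \<in> B \<Longrightarrow> 2 \<le> dg x"
  and d_Der: "d \<in> Der B dg (- 1)"
  and d_d: "p \<in> Lam B dg \<Longrightarrow> d (d p) = 0"
  and d_decomposable: "x \<in> B \<Longrightarrow> d (gen x) \<in> Lam_decomposable B dg"
  using sc_minimal_model by (auto simp: sc_minimal_model_def)

lemma emb_decomposable:
  assumes "p \<in> Lam_decomposable B dg"
  shows "emb p \<in> FilV B dg 2" "emb p \<in> FilS B dg 2"
proof -
  have *: "weight (\<lambda>x. if fst x then 0 else 1) (emb_mono M) = int (size M)" for M :: "'v multiset"
    by (induction M) auto
  show "emb p \<in> FilV B dg 2" "emb p \<in> FilS B dg 2"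
    using assms unfolding Fil_def Lam_decomposable_eq_lspan
    by (auto elim!: emb_in_lspan simp: emb_mono_lmonos * weight_const)
qed

text \<open>Suspended generators still have degree at least 1. The bound makes the recursion on word
  length in a fixed degree terminate.\<close>

lemma size_le_mdeg: "M \<in> lmonos (cB B) (cdg dg) \<Longrightarrow> size M \<le> mdeg (cdg dg) M"
proof (induction M)
  case (add x M)
  from lmonos_add_mset[OF add.prems] add.IH dg_ge_2[of "snd x"] show ?case
    by (cases x) (auto simp: cdg_def cB_def split: if_splits)
qed simp

text \<open>A stage of the closure differential: its square is required to vanish only on
  suspensions of generators of degree at most \<open>k\<close>. The correction to the leading term
  \<open>gen (False, v)\<close> is decomposable, so the linear part of \<open>D\<close> is the
  Koszul differential, and every term of it has an unsuspended factor, which keeps the suspensions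
  occurring there of low degree.\<close>

definition closure_diff :: "nat \<Rightarrow> ((bool \<times> 'v) lam \<Rightarrow> (bool \<times> 'v) lam) \<Rightarrow> bool" where
  "closure_diff k D \<longleftrightarrow> D \<in> Der (cB B) (cdg dg) (- 1) \<and>
    (\<forall>v\<in>B. D (gen (False, v)) = emb (d (gen v))) \<and>
    (\<forall>v\<in>B. D (gen (True, v)) - gen (False, v) \<in> FilV B dg 1 \<inter> FilS B dg 2) \<and>
    (\<forall>v\<in>B. dg v \<le> k \<longrightarrow> D (D (gen (True, v))) = 0)"

text \<open>An unsuspended factor takes up at least 2 of the total degree \<open>k + 1\<close>,
  which leaves at most \<open>k - 1\<close> for the suspension of \<open>v\<close>.\<close>

lemma low_degree_gens:
  assumes "q \<in> Lam_deg (cB B) (cdg dg) (int k + 1)" "q \<in> FilV B dg 1"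
    and "M \<in> Poly_Mapping.keys q" "(True, v) \<in># M"
  shows "v \<in> B" "dg v \<le> k"
proof -
  have M: "M \<in> lmonos (cB B) (cdg dg)" "mdeg (cdg dg) M = k + 1"
    using assms(1,3) by (auto simp: Lam_deg_def Lam_def)
  have "1 \<le> weight (\<lambda>x. if fst x then 0 else 1) M"
    using assms(2,3) by (auto simp: Fil_def lspan_def)
  then obtain u where u: "(False, u) \<in># M" by (rule weight_V_pos)
  obtain M' where M': "M = add_mset (True, v) M'"
    using assms(4) by (metis insert_DiffM)
  with u have "(False, u) \<in># M'" by auto
  then obtain M'' where "M' = add_mset (False, u) M''" by (metis insert_DiffM)
  with M M' have *: "dg v - 1 + dg u + mdeg (cdg dg) M'' = k + 1" by simp
  show "v \<in> B" using M(1) assms(4) by (auto simp: lmonos_def)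
  moreover have "u \<in> B" using M(1) u by (auto simp: lmonos_def)
  ultimately show "dg v \<le> k" using * dg_ge_2[of u] dg_ge_2[of v] by linarith
qed

text \<open>\<open>D\<close> is odd, so its square is tested on generators; on unsuspended ones it
  is the image of \<open>d (d (gen v)) = 0\<close>.\<close>

lemma closure_diff_square:
  assumes "closure_diff k D" "p \<in> Lam (cB B) (cdg dg)"
    and "\<And>M v. M \<in> Poly_Mapping.keys p \<Longrightarrow> (True, v) \<in># M \<Longrightarrow> v \<in> B \<Longrightarrow> dg v \<le> k"
  shows "D (D p) = 0"
proof (rule Der_square[of D "cB B" "cdg dg" "- 1"])
  show D: "D \<in> Der (cB B) (cdg dg) (- 1)" using assms(1) by (simp add: closure_diff_def)
  fix M x assume x: "M \<in> Poly_Mapping.keys p" "x \<in># M"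
  obtain b v where bv: "x = (b, v)" by (cases x)
  have "x \<in> cB B" using x assms(2) by (auto simp: Lam_def lmonos_def)
  with bv have v: "v \<in> B" by simp
  show "D (D (gen x)) = 0"
  proof (cases b)
    case True
    then show ?thesis
      using assms(1) assms(3)[OF x(1) _ v] x(2) bv v by (simp add: closure_diff_def)
  next
    case False
    have "D (emb (d (gen v))) = emb (d (d (gen v)))"
      using assms(1) by (intro Der_emb[OF D d_Der] Der_Lam[OF d_Der] gen_in_Lam v) (auto simp: closure_diff_def)
    then show ?thesis
      using assms(1) v bv False by (simp add: closure_diff_def d_d gen_in_Lam)
  qed
qed (use assms(2) in simp_all)

text \<open>Both kinds of generator gain an unsuspended factor: \<open>D\<close> of a suspension has
  one in each term, and \<open>d\<close> of a generator is decomposable.\<close>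

lemma closure_diff_FilV:
  assumes "closure_diff k D" "p \<in> FilV B dg i"
  shows "D p \<in> FilV B dg (i + 1)"
proof (rule Der_Fil[OF _ _ assms(2)])
  show "D \<in> Der (cB B) (cdg dg) (- 1)" using assms(1) by (simp add: closure_diff_def)
  fix x :: "bool \<times> 'v" assume x: "x \<in> cB B"
  obtain b v where bv: "x = (b, v)" by (cases x)
  with x have v: "v \<in> B" by simp
  have "gen (False, v) \<in> FilV B dg 1" using v by (intro gen_in_Fil) auto
  moreover have "D (gen (True, v)) - gen (False, v) \<in> FilV B dg 1"
    using assms(1) v by (auto simp: closure_diff_def)
  ultimately have "D (gen (True, v)) \<in> FilV B dg 1"
    using Fil_add by fastforce
  moreover have "D (gen (False, v)) \<in> FilV B dg 2"
    using emb_decomposable(1)[OF d_decomposable[OF v]] assms(1) v by (simp add: closure_diff_def)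
  ultimately show "D (gen x) \<in> FilV B dg ((if fst x then 0 else 1) + 1)"
    using bv by (cases b) auto
qed

text \<open>The derivations \<open>del\<close> and \<open>s\<close> exchange each generator with its
  suspension in opposite directions. Their graded commutator is \<open>del s + s del\<close>, a
  derivation fixing every generator, hence the Euler derivation.\<close>

lemma koszul_contraction:
  obtains del s where "del \<in> Der (cB B) (cdg dg) (- 1)" "s \<in> Der (cB B) (cdg dg) 1"
    and "\<And>v. v \<in> B \<Longrightarrow> del (gen (False, v)) = 0" "\<And>v. v \<in> B \<Longrightarrow> del (gen (True, v)) = gen (False, v)"
    and "\<And>v. v \<in> B \<Longrightarrow> s (gen (False, v)) = gen (True, v)" "\<And>v. v \<in> B \<Longrightarrow> s (gen (True, v)) = 0"
    and "\<And>p m. p \<in> lspan {M \<in> lmonos (cB B) (cdg dg). size M = m} \<Longrightarrow>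
      del (s p) + s (del p) = lscale (of_nat m) p"
proof -
  define u where "u x = (if fst x then gen (False, snd x) else 0 :: (bool \<times> 'v) lam)" for x
  have "u x \<in> Lam_deg (cB B) (cdg dg) (int (cdg dg x) - (- 1))" if "x \<in> cB B" for x
    using that dg_ge_2[of "snd x"] gen_in_Lam_deg[of "(False, snd x)" "cB B" "cdg dg"]
    by (auto simp: u_def cB_def cdg_def of_nat_diff)
  then obtain del where del: "del \<in> Der (cB B) (cdg dg) (- 1)" "\<And>x. x \<in> cB B \<Longrightarrow> del (gen x) = u x"
    using Der_exists[of "cB B" u "cdg dg" "- 1"] by blast
  define w where "w x = (if fst x then 0 else gen (True, snd x) :: (bool \<times> 'v) lam)" for x
  have "w x \<in> Lam_deg (cB B) (cdg dg) (int (cdg dg x) - 1)" if "x \<in> cB B" for x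
    using that dg_ge_2[of "snd x"] gen_in_Lam_deg[of "(True, snd x)" "cB B" "cdg dg"]
    by (auto simp: w_def cB_def cdg_def of_nat_diff)
  then obtain s where s: "s \<in> Der (cB B) (cdg dg) 1" "\<And>x. x \<in> cB B \<Longrightarrow> s (gen x) = w x"
    using Der_exists[of "cB B" w "cdg dg" 1] by blast
  have br: "((del \<circ> s) - ksign (- 1 * 1) (s \<circ> del)) p = del (s p) + s (del p)" for p
    by (simp add: ksign_def)
  have E: "((del \<circ> s) - ksign (- 1 * 1) (s \<circ> del)) \<in> Der (cB B) (cdg dg) 0"
    using Der_bracket[OF del(1) s(1)] by simp
  show thesis
  proof (rule that[OF del(1) s(1)])
    fix p m assume p: "p \<in> lspan {M \<in> lmonos (cB B) (cdg dg). size M = m}"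
    have "((del \<circ> s) - ksign (- 1 * 1) (s \<circ> del)) (gen x) = gen x" if "x \<in> cB B" for x
      unfolding br using that
      by (cases x; cases "fst x") (auto simp: s(2) del(2) u_def w_def Der_zero[OF del(1)] Der_zero[OF s(1)])
    from euler_derivation[OF E this p] show "del (s p) + s (del p) = lscale (of_nat m) p"
      unfolding br by simp
  qed (simp_all add: del(2) s(2) u_def w_def)
qed

text \<open>The part of \<open>D\<close> that preserves word length is the Koszul differential \<open>del\<close>, and
  \<open>del s + s del\<close> is multiplication by the word length; so a primitive is found one word
  length at a time.\<close>

lemma closure_fill:
  assumes D: "closure_diff k D"
  shows "r \<in> Lam_deg (cB B) (cdg dg) (int k + 2) \<Longrightarrow> r \<in> FilV B dg 2 \<Longrightarrow> r \<in> FilS B dg (int m) \<Longrightarrow>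
    1 \<le> m \<Longrightarrow> D r = 0 \<Longrightarrow>
    \<exists>q. q \<in> Lam_deg (cB B) (cdg dg) (int k + 1) \<and> q \<in> FilV B dg 1 \<and> q \<in> FilS B dg (int m) \<and> D q = r"
proof (induction "k + 3 - m" arbitrary: m r rule: less_induct)
  case less
  let ?W = "cB B" and ?g = "cdg dg"
  have DD: "D \<in> Der ?W ?g (- 1)" using D by (simp add: closure_diff_def)
  have DF: "D (gen (False, v)) = emb (d (gen v))" if "v \<in> B" for v
    using D that by (simp add: closure_diff_def)
  have DT: "D (gen (True, v)) - gen (False, v) \<in> FilV B dg 1" "D (gen (True, v)) - gen (False, v) \<in> FilS B dg 2"
    if "v \<in> B" for v
    using D that by (auto simp: closure_diff_def)
  show ?case
  proof (cases "k + 2 < m")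
    \<comment> \<open>The word length would exceed the degree \<open>k + 2\<close>, so nothing is
      left to fill.\<close>
    case True
    have "M \<in> {}" if "M \<in> Poly_Mapping.keys r" for M
    proof -
      have "M \<in> lmonos ?W ?g" "mdeg ?g M = k + 2" "m \<le> size M"
        using that less.prems(1,3) by (auto simp: Lam_deg_def Lam_def Fil_def lspan_def weight_const)
      with size_le_mdeg[of M] True show ?thesis by simp
    qed
    then have "r \<in> lspan {}" unfolding lspan_def by blast
    then have "r = 0" by (simp add: lspan_empty)
    then show ?thesis using Der_zero[OF DD] by (intro exI[of _ 0]) simp
  next
    case False
    obtain del s where del: "del \<in> Der ?W ?g (- 1)" and s: "s \<in> Der ?W ?g 1"
      and delF: "\<And>v. v \<in> B \<Longrightarrow> del (gen (False, v)) = 0"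
      and delT: "\<And>v. v \<in> B \<Longrightarrow> del (gen (True, v)) = gen (False, v)"
      and sF: "\<And>v. v \<in> B \<Longrightarrow> s (gen (False, v)) = gen (True, v)"
      and sT: "\<And>v. v \<in> B \<Longrightarrow> s (gen (True, v)) = 0"
      and contr: "\<And>p m. p \<in> lspan {M \<in> lmonos ?W ?g. size M = m} \<Longrightarrow>
        del (s p) + s (del p) = lscale (of_nat m) p"
      by (rule koszul_contraction) (rule that)
    note D_V = closure_diff_FilV[OF D]
    have s_V: "s p \<in> FilV B dg (i + (- 1))" if "p \<in> FilV B dg i" for p i
    proof (rule Der_Fil[OF s _ that])
      fix x assume "x \<in> ?W"
      then show "s (gen x) \<in> FilV B dg ((if fst x then 0 else 1) + (- 1))"
        by (cases x; cases "fst x") (auto simp: sF sT intro: gen_in_Fil)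
    qed
    have s_S: "s p \<in> FilS B dg (i + 0)" if "p \<in> FilS B dg i" for p i
    proof (rule Der_Fil[OF s _ that])
      fix x assume "x \<in> ?W"
      then show "s (gen x) \<in> FilS B dg (1 + 0)"
        by (cases x; cases "fst x") (auto simp: sF sT intro: gen_in_Fil)
    qed
    \<comment> \<open>The constant \<open>c\<close> is kept general: the values 1 and -1 together
      show that \<open>del\<close> preserves word length exactly.\<close>
    have del_S: "del p \<in> Fil ?W ?g (\<lambda>_. c) (i + 0)" if "p \<in> Fil ?W ?g (\<lambda>_. c) i" for p i c
    proof (rule Der_Fil[OF del _ that])
      fix x assume "x \<in> ?W"
      then show "del (gen x) \<in> Fil ?W ?g (\<lambda>_. c) (c + 0)"
        by (cases x; cases "fst x") (auto simp: delF delT intro: gen_in_Fil)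
    qed
    \<comment> \<open>The part of \<open>D\<close> that raises word length.\<close>
    define E where "E = D - del"
    have E: "E \<in> Der ?W ?g (- 1)" unfolding E_def by (rule Der_diff_in_Der[OF DD del])
    have D_eq: "D p = del p + E p" for p by (simp add: E_def)
    have E_S: "E p \<in> FilS B dg (i + 1)" if "p \<in> FilS B dg i" for p i
    proof (rule Der_Fil[OF E _ that])
      fix x assume x: "x \<in> ?W"
      obtain b v where bv: "x = (b, v)" by (cases x)
      with x have v: "v \<in> B" by simp
      show "E (gen x) \<in> FilS B dg (1 + 1)"
        using emb_decomposable(2)[OF d_decomposable[OF v]] DF[OF v] DT(2)[OF v] bv delF[OF v] delT[OF v]
        by (cases b) (auto simp: E_def)
    qed
    define rm where "rm = part (\<lambda>M. size M = m) r"
    define r' where "r' = r - rm"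
    have rL: "r \<in> Lam ?W ?g" using less.prems(1) by (rule Lam_deg_subset_Lam)
    have rm_lspan: "rm \<in> lspan {M \<in> lmonos ?W ?g. size M = m}"
      using part_in_lspan[of r "lmonos ?W ?g"] rL by (simp add: rm_def Lam_eq_lspan)
    have rm_deg: "rm \<in> Lam_deg ?W ?g (int k + 2)"
      using part_in_lspan[OF less.prems(1)[unfolded Lam_deg_eq_lspan]]
      unfolding rm_def Lam_deg_eq_lspan by (auto simp: lspan_def)
    have rm_V: "rm \<in> FilV B dg 2"
      using part_in_lspan[OF less.prems(2)[unfolded Fil_def]]
      unfolding rm_def Fil_def by (auto simp: lspan_def)
    have rm_S: "rm \<in> FilS B dg (int m)" "rm \<in> Fil ?W ?g (\<lambda>_. - 1) (- int m)"
      using rm_lspan by (auto simp: Fil_def lspan_def weight_const)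
    have r'_S: "r' \<in> FilS B dg (int m + 1)"
      using minus_part_in_lspan[OF less.prems(3)[unfolded Fil_def], of "\<lambda>M. size M = m"]
      unfolding r'_def rm_def Fil_def by (fastforce simp: lspan_def weight_const)
    have rmL: "rm \<in> Lam ?W ?g" and r'L: "r' \<in> Lam ?W ?g"
      using rm_S(1) r'_S by (auto intro: Fil_subset_Lam)
    have r: "r = rm + r'" by (simp add: r'_def)
    \<comment> \<open>This isolates the lowest word length in \<open>D r = 0\<close>: the left side
      has word length at most \<open>m\<close>, the right side at least \<open>m + 1\<close>, so
      both vanish.\<close>
    have "del rm = - (D r') - E rm"
    proof -
      have "0 = D rm + D r'"
        using less.prems(5) Der_add[OF DD rmL r'L] unfolding r by simp
      then show ?thesis using D_eq[of rm] by (simp add: algebra_simps add_eq_0_iff)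
    qed
    moreover have "D r' \<in> FilS B dg (int m + 1)"
      unfolding D_eq using del_S[OF r'_S] E_S[OF r'_S] Fil_mono[of "int m + 1" "int m + 1 + 1" ?W ?g "\<lambda>_. 1"]
      by (intro Fil_add) auto
    moreover have "E rm \<in> FilS B dg (int m + 1)" by (rule E_S[OF rm_S(1)])
    ultimately have "del rm \<in> FilS B dg (int m + 1)" by (simp add: Fil_diff Fil_uminus)
    moreover have "del rm \<in> Fil ?W ?g (\<lambda>_. - 1) (- int m)" using del_S[OF rm_S(2)] by simp
    moreover have "{M \<in> lmonos ?W ?g. int m + 1 \<le> weight (\<lambda>_. 1) M} \<inter>
        {M \<in> lmonos ?W ?g. - int m \<le> weight (\<lambda>_. - 1) M} = {}"
      by (auto simp: weight_const)
    ultimately have del_rm: "del rm = 0"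
      unfolding Fil_def by (rule lspan_disjoint)
    \<comment> \<open>Since \<open>del rm = 0\<close>, the contraction identity gives
      \<open>del (s rm) = m rm\<close>. As \<open>s\<close> replaces one unsuspended factor by a
      suspended one, starting in \<open>FilV\<close> level 2 leaves \<open>q\<close> in level
      1.\<close>
    define q where "q = lscale (1 / of_nat m) (s rm)"
    have s_rm: "s rm \<in> Lam ?W ?g" by (rule Der_Lam[OF s rmL])
    have q_deg: "q \<in> Lam_deg ?W ?g (int k + 1)"
      using Lam_deg_lscale[OF Der_deg[OF s rm_deg]] by (simp add: q_def add.commute)
    have q_V: "q \<in> FilV B dg 1" using Fil_lscale[OF s_V[OF rm_V]] by (simp add: q_def)
    have q_S: "q \<in> FilS B dg (int m)" using Fil_lscale[OF s_S[OF rm_S(1)]] by (simp add: q_def)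
    have qL: "q \<in> Lam ?W ?g" by (rule Fil_subset_Lam[OF q_S])
    have "del q = rm"
      using contr[OF rm_lspan] del_rm \<open>1 \<le> m\<close>
      by (simp add: q_def Der_lscale[OF del s_rm] Der_zero[OF s])
    then have Dq: "r - D q = r' - E q" using D_eq[of q] r by simp
    have DqL: "D q \<in> Lam ?W ?g" by (rule Der_Lam[OF DD qL])
    have "\<exists>q'. q' \<in> Lam_deg ?W ?g (int k + 1) \<and> q' \<in> FilV B dg 1 \<and>
        q' \<in> FilS B dg (int (m + 1)) \<and> D q' = r - D q"
    proof (rule less.hyps)
      show "k + 3 - (m + 1) < k + 3 - m" using False by simp
      show "r - D q \<in> Lam_deg ?W ?g (int k + 2)"
        using Der_deg[OF DD q_deg] less.prems(1) by (intro Lam_deg_diff) (simp_all add: add.commute)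
      show "r - D q \<in> FilV B dg 2"
        using D_V[OF q_V] less.prems(2) by (intro Fil_diff) simp_all
      show "r - D q \<in> FilS B dg (int (m + 1))"
        unfolding Dq using E_S[OF q_S] r'_S by (intro Fil_diff) (simp_all add: add.commute)
      \<comment> \<open>The degree of \<open>q\<close> and its unsuspended factors confine its
        suspensions to generators of degree at most \<open>k\<close>, where the square of
        \<open>D\<close> vanishes.\<close>
      show "D (r - D q) = 0"
        using closure_diff_square[OF D qL low_degree_gens(2)[OF q_deg q_V]] less.prems(5)
        by (simp add: Der_diff[OF DD rL DqL])
    qed simp
    then obtain q' where q': "q' \<in> Lam_deg ?W ?g (int k + 1)" "q' \<in> FilV B dg 1"
      "q' \<in> FilS B dg (int (m + 1))" "D q' = r - D q" by blast
    have "q' \<in> FilS B dg (int m)"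
      using q'(3) Fil_mono[of "int m" "int (m + 1)" ?W ?g "\<lambda>_. 1"] by auto
    moreover have "D (q + q') = r"
      using Der_add[OF DD qL Fil_subset_Lam[OF q'(3)]] q'(4) by simp
    ultimately show ?thesis
      using q' q_deg q_V q_S by (intro exI[of _ "q + q'"]) (simp add: Fil_add Lam_deg_add)
  qed
qed

text \<open>In the induction step, \<open>emb (d (gen v))\<close> is a cycle and has a primitive
  \<open>q v\<close>; sending the suspension of \<open>v\<close> to
  \<open>gen (False, v) - q v\<close> makes the square vanish there.\<close>

lemma closure_diff_exists: "\<exists>D. closure_diff k D"
proof (induction k)
  case 0
  \<comment> \<open>The Koszul choice. Generators have degree at least 2, so at stage 0 the
    condition on squares is vacuous.\<close>
  define u where "u x = (if fst x then gen (False, snd x) else emb (d (gen (snd x))))" for x :: "bool \<times> 'v"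
  have "u x \<in> Lam_deg (cB B) (cdg dg) (int (cdg dg x) - (- 1))" if "x \<in> cB B" for x
    using that dg_ge_2[of "snd x"] gen_in_Lam_deg[of "(False, snd x)" "cB B" "cdg dg"]
      emb_in_Lam_deg[OF Der_deg[OF d_Der gen_in_Lam_deg[of "snd x" B dg]]]
    by (auto simp: u_def cB_def cdg_def of_nat_diff)
  then obtain D where "D \<in> Der (cB B) (cdg dg) (- 1)" "\<And>x. x \<in> cB B \<Longrightarrow> D (gen x) = u x"
    using Der_exists[of "cB B" u "cdg dg" "- 1"] by blast
  then have "closure_diff 0 D"
    using dg_ge_2 by (fastforce simp: closure_diff_def u_def)
  then show ?case by blast
next
  case (Suc k)
  let ?W = "cB B" and ?g = "cdg dg"
  from Suc obtain D where cD: "closure_diff k D" by blast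
  then have D: "D \<in> Der ?W ?g (- 1)" and DF: "\<And>v. v \<in> B \<Longrightarrow> D (gen (False, v)) = emb (d (gen v))"
    and DT: "\<And>v. v \<in> B \<Longrightarrow> D (gen (True, v)) - gen (False, v) \<in> FilV B dg 1 \<inter> FilS B dg 2"
    and D2: "\<And>v. v \<in> B \<Longrightarrow> dg v \<le> k \<Longrightarrow> D (D (gen (True, v))) = 0"
    by (auto simp: closure_diff_def)
  have "\<forall>v\<in>{v \<in> B. dg v = Suc k}. \<exists>q. q \<in> Lam_deg ?W ?g (int k + 1) \<and> q \<in> FilV B dg 1 \<and>
      q \<in> FilS B dg (int 2) \<and> D q = emb (d (gen v))"
  proof
    fix v assume v: "v \<in> {v \<in> B. dg v = Suc k}"
    then have vB: "v \<in> B" by simp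
    show "\<exists>q. q \<in> Lam_deg ?W ?g (int k + 1) \<and> q \<in> FilV B dg 1 \<and>
      q \<in> FilS B dg (int 2) \<and> D q = emb (d (gen v))"
    proof (rule closure_fill[OF cD])
      show "emb (d (gen v)) \<in> Lam_deg ?W ?g (int k + 2)"
        using emb_in_Lam_deg[OF Der_deg[OF d_Der gen_in_Lam_deg[OF vB]]] v by (simp add: add.commute)
      show "emb (d (gen v)) \<in> FilV B dg 2" "emb (d (gen v)) \<in> FilS B dg (int 2)"
        using emb_decomposable[OF d_decomposable[OF vB]] by simp_all
      show "D (emb (d (gen v))) = 0"
        using Der_emb[OF D d_Der DF Der_Lam[OF d_Der gen_in_Lam[OF vB]]] d_d[OF gen_in_Lam[OF vB]] by simp
    qed simp
  qed
  then obtain q where q: "\<And>v. v \<in> B \<Longrightarrow> dg v = Suc k \<Longrightarrow> q v \<in> Lam_deg ?W ?g (int k + 1)"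
    "\<And>v. v \<in> B \<Longrightarrow> dg v = Suc k \<Longrightarrow> q v \<in> FilV B dg 1"
    "\<And>v. v \<in> B \<Longrightarrow> dg v = Suc k \<Longrightarrow> q v \<in> FilS B dg 2"
    "\<And>v. v \<in> B \<Longrightarrow> dg v = Suc k \<Longrightarrow> D (q v) = emb (d (gen v))"
    unfolding bchoice_iff by auto
  define u where "u x = (if fst x \<and> dg (snd x) = Suc k then gen (False, snd x) - q (snd x) else D (gen x))" for x
  have "u x \<in> Lam_deg ?W ?g (int (?g x) - (- 1))" if x: "x \<in> ?W" for x
  proof (cases "fst x \<and> dg (snd x) = Suc k")
    case True
    then have "snd x \<in> B" "u x = gen (False, snd x) - q (snd x)" "int (?g x) - (- 1) = int k + 1"
      using x dg_ge_2[of "snd x"] by (auto simp: u_def cB_def cdg_def)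
    then show ?thesis
      using q(1)[of "snd x"] True gen_in_Lam_deg[of "(False, snd x)" ?W ?g]
      by (simp add: Lam_deg_diff add.commute)
  next
    case False
    then show ?thesis using Der_deg[OF D gen_in_Lam_deg[OF x]] by (auto simp: u_def)
  qed
  then obtain D' where D': "D' \<in> Der ?W ?g (- 1)" "\<And>x. x \<in> ?W \<Longrightarrow> D' (gen x) = u x"
    using Der_exists[of ?W u ?g "- 1"] by blast
  \<comment> \<open>By \<open>low_degree_gens\<close> such elements contain no suspension whose
    value was changed, so \<open>q v\<close> is still a primitive for \<open>D'\<close>.\<close>
  have agree: "D' p = D p" if "p \<in> Lam_deg ?W ?g (int k + 1)" "p \<in> FilV B dg 1" for p
  proof (rule Der_eqI[OF D'(1) D Lam_deg_subset_Lam[OF that(1)]])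
    fix M x assume x: "M \<in> Poly_Mapping.keys p" "x \<in># M"
    have "x \<in> ?W" using x Lam_deg_subset_Lam[OF that(1)] by (auto simp: Lam_def lmonos_def)
    moreover have "\<not> (fst x \<and> dg (snd x) = Suc k)"
      using low_degree_gens(2)[OF that x(1), of "snd x"] x(2) by (cases x) auto
    ultimately show "D' (gen x) = D (gen x)" by (simp only: D'(2) u_def if_False)
  qed
  have "closure_diff (Suc k) D'"
    unfolding closure_diff_def
  proof (intro conjI ballI impI)
    show "D' \<in> Der ?W ?g (- 1)" by (rule D'(1))
    fix v assume v: "v \<in> B"
    show "D' (gen (False, v)) = emb (d (gen v))" using v by (simp add: D'(2) u_def DF)
    show "D' (gen (True, v)) - gen (False, v) \<in> FilV B dg 1 \<inter> FilS B dg 2"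
      using v DT[OF v] q(2,3)[OF v] by (auto simp: D'(2) u_def Fil_uminus)
    assume vk: "dg v \<le> Suc k"
    show "D' (D' (gen (True, v))) = 0"
    proof (cases "dg v = Suc k")
      case True
      have "D' (gen (False, v) - q v) = D' (gen (False, v)) - D' (q v)"
        using v q(1)[OF v True] by (intro Der_diff[OF D'(1)]) (auto intro: gen_in_Lam Lam_deg_subset_Lam)
      also have "\<dots> = 0"
        using v q[OF v True] agree[of "q v"] by (simp add: D'(2) u_def DF)
      finally show ?thesis using v True by (simp add: D'(2) u_def)
    next
      case False
      with vk have vk: "dg v \<le> k" by simp
      let ?z = "D (gen (True, v))"
      have "gen (False, v) \<in> FilV B dg 1" using v by (intro gen_in_Fil) auto
      from Fil_add[OF this] DT[OF v] have zV: "?z \<in> FilV B dg 1" by fastforce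
      \<comment> \<open>The degree is written so that \<open>low_degree_gens\<close> applies with
        \<open>dg v - 1\<close>: suspensions occurring in \<open>?z\<close> come from generators of
        smaller degree than \<open>v\<close>.\<close>
      have zd: "?z \<in> Lam_deg ?W ?g (int (dg v - 1) + 1)"
        using Der_deg[OF D gen_in_Lam_deg[of "(True, v)"]] v by simp
      have "D' ?z = D ?z"
      proof (rule Der_eqI[OF D'(1) D Lam_deg_subset_Lam[OF zd]])
        fix M x assume x: "M \<in> Poly_Mapping.keys ?z" "x \<in># M"
        have "x \<in> ?W" using x Lam_deg_subset_Lam[OF zd] by (auto simp: Lam_def lmonos_def)
        moreover have "\<not> (fst x \<and> dg (snd x) = Suc k)"
          using low_degree_gens(2)[OF zd zV x(1), of "snd x"] x(2) vk by (cases x) auto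
        ultimately show "D' (gen x) = D (gen x)" by (simp only: D'(2) u_def if_False)
      qed
      then show ?thesis using v False D2[OF v vk] by (simp add: D'(2) u_def)
    qed
  qed
  then show ?case by blast
qed

end

section \<open>Mapping the acyclic closure to the derivations\<close>

lemma Der_zero_in_Der [simp]: "0 \<in> Der B dg k"
  by (auto simp: Der_def ksign_def)

lemma Der_add_in_Der:
  assumes "\<theta> \<in> Der B dg k" "\<eta> \<in> Der B dg k"
  shows "\<theta> + \<eta> \<in> Der B dg k"
  using Der_diff_in_Der[OF assms(1) Der_diff_in_Der[OF Der_zero_in_Der assms(2)]] by simp

lemma Der_lscale_in_Der:
  assumes "\<theta> \<in> Der B dg k"
  shows "(\<lambda>p. lscale c (\<theta> p)) \<in> Der B dg k"
  using lmult_Der_in_Der[OF assms single_in_Lam_deg[of "{#}" B dg c]] by simp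

lemma der_diff_eq_bracket: "der_diff d k \<theta> = (d \<circ> \<theta>) - ksign (- 1 * k) (\<theta> \<circ> d)"
  by (simp add: der_diff_def ksign_def)

lemma der_diff_apply: "der_diff d k \<theta> p = d (\<theta> p) - ksign k (\<theta> (d p))"
  by (simp add: der_diff_def ksign_apply)

lemma der_diff_in_Der:
  assumes "d \<in> Der B dg (- 1)" "\<theta> \<in> Der B dg k"
  shows "der_diff d k \<theta> \<in> Der B dg (k - 1)"
  unfolding der_diff_eq_bracket using Der_bracket[OF assms] by simp

lemma der_diff_zero: "d \<in> Der B dg (- 1) \<Longrightarrow> der_diff d k 0 = 0"
  by (rule ext) (simp add: der_diff_apply Der_zero ksign_def)

lemma der_diff_add:
  assumes "d \<in> Der B dg (- 1)" "\<theta> \<in> Der B dg k" "\<eta> \<in> Der B dg k"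
  shows "der_diff d k (\<theta> + \<eta>) = der_diff d k \<theta> + der_diff d k \<eta>"
proof
  fix p show "der_diff d k (\<theta> + \<eta>) p = (der_diff d k \<theta> + der_diff d k \<eta>) p"
    using assms
    by (cases "p \<in> Lam B dg")
      (auto simp: der_diff_apply Der_add Der_Lam Der_outside Der_zero ksign_eq_lscale lscale_add)
qed

lemma der_diff_lscale:
  assumes "d \<in> Der B dg (- 1)" "\<theta> \<in> Der B dg k"
  shows "der_diff d k (\<lambda>p. lscale c (\<theta> p)) = (\<lambda>p. lscale c (der_diff d k \<theta> p))"
proof
  fix p show "der_diff d k (\<lambda>p. lscale c (\<theta> p)) p = lscale c (der_diff d k \<theta> p)"
    using assms
    by (cases "p \<in> Lam B dg")
      (auto simp: der_diff_apply Der_lscale Der_Lam Der_outside Der_zero ksign_eq_lscale lscale_diff mult.commute)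
qed

text \<open>The derivations form a dg module over the minimal model. Hence a linear map out of the
  closure is a chain map as soon as it is one on cells.\<close>

lemma der_diff_lmult:
  assumes d: "d \<in> Der B dg (- 1)" and \<theta>: "\<theta> \<in> Der B dg k" and a: "a \<in> Lam_deg B dg l"
  shows "der_diff d (k - l) (\<lambda>p. lmult dg a (\<theta> p)) p =
    lmult dg (d a) (\<theta> p) + ksign l (lmult dg a (der_diff d k \<theta> p))"
proof (cases "p \<in> Lam B dg")
  case True
  then show ?thesis
    using Der_leibniz[OF d a Der_Lam[OF \<theta> True]]
    by (simp add: der_diff_apply ksign_eq_lscale lmult_diff_right lscale_diff lmult_lscale_right psign_diff mult.commute)
next
  case False
  then show ?thesis
    using assms by (simp add: der_diff_apply Der_outside Der_zero ksign_def)
qed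

text \<open>The coefficient of a monomial over its cell. It is untagged, so that it can act on
  derivations of the original algebra, whereas \<open>cell\<close> stays in the closure, where
  \<open>D\<close> applies to it.\<close>

definition vpart :: "(bool \<times> 'v) multiset \<Rightarrow> 'v multiset" where
  "vpart M = image_mset snd (filter_mset (\<lambda>x. \<not> fst x) M)"

definition cell :: "(bool \<times> 'v) multiset \<Rightarrow> (bool \<times> 'v) multiset" where
  "cell M = filter_mset fst M"

lemma vpart_simps [simp]:
  "vpart {#} = {#}" "vpart (M + N) = vpart M + vpart N" "vpart (emb_mono K) = K"
  "vpart (add_mset (False, v) M) = add_mset v (vpart M)" "vpart (add_mset (True, v) M) = vpart M"
  "vpart (cell M) = {#}"
  by (induction K) (simp_all add: vpart_def cell_def)

lemma cell_simps [simp]: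
  "cell {#} = {#}" "cell (M + N) = cell M + cell N" "cell (emb_mono K) = {#}"
  "cell (add_mset (False, v) M) = cell M" "cell (add_mset (True, v) M) = add_mset (True, v) (cell M)"
  by (induction K) (simp_all add: cell_def)

lemma cell_cell [simp]: "cell (cell M) = cell M"
  by (induction M) (simp_all add: cell_def)

lemma emb_vpart_add_cell: "emb_mono (vpart M) + cell M = M"
proof (induction M)
  case (add x M)
  then show ?case by (cases x; cases "fst x") auto
qed simp

lemma mdeg_split: "mdeg (cdg dg) M = mdeg dg (vpart M) + mdeg (cdg dg) (cell M)"
  by (subst emb_vpart_add_cell[of M, symmetric]) simp

lemma lmonos_split:
  assumes "M \<in> lmonos (cB B) (cdg dg)"
  shows "vpart M \<in> lmonos B dg" "cell M \<in> lmonos (cB B) (cdg dg)"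
proof -
  have *: "emb_mono (vpart M) \<in> lmonos (cB B) (cdg dg) \<and> cell M \<in> lmonos (cB B) (cdg dg)"
    using assms add_in_lmonos_iff[of "emb_mono (vpart M)" "cell M"] by (simp add: emb_vpart_add_cell)
  then show "cell M \<in> lmonos (cB B) (cdg dg)" by blast
  show "vpart M \<in> lmonos B dg"
    unfolding lmonos_def
  proof (intro CollectI conjI allI impI)
    show "set_mset (vpart M) \<subseteq> B"
      using * by (auto simp: lmonos_def)
    fix x assume "odd (dg x)"
    then have "odd (cdg dg (False, x))" by simp
    with * have "count (emb_mono (vpart M)) (False, x) \<le> 1" unfolding lmonos_def by blast
    then show "count (vpart M) x \<le> 1" by (simp add: count_emb_mono)
  qed
qed

lemma weight_V_eq: "weight (\<lambda>x. if fst x then 0 else 1) M = int (size (vpart M))"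
proof (induction M)
  case (add x M)
  then show ?case by (cases x; cases "fst x") auto
qed simp

text \<open>Suspended generators come last in the order, so unsuspended generators on their left
  form no inversion with them.\<close>

lemma mono_sign_emb_left: "mono_sign (cdg dg) (emb_mono M) N = mono_sign dg M (vpart N)"
proof -
  have o: "odds dg (vpart N) = {v. (False, v) \<in> odds (cdg dg) N}"
    by (force simp: odds_def vpart_def)
  have "{(x, y). x \<in> Pair False ` odds dg M \<and> y \<in> odds (cdg dg) N \<and> y < x} =
      map_prod (Pair False) (Pair False) ` {(x, y). x \<in> odds dg M \<and> y \<in> odds dg (vpart N) \<and> y < x}"
    by (auto simp: o image_iff)
  then have "inversions (Pair False ` odds dg M) (odds (cdg dg) N) = inversions (odds dg M) (odds dg (vpart N))"
    unfolding inversions_def by (simp add: card_image inj_on_def)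
  moreover have "Pair False ` odds dg M \<inter> odds (cdg dg) N = {} \<longleftrightarrow> odds dg M \<inter> odds dg (vpart N) = {}"
    by (auto simp: o)
  ultimately show ?thesis by (simp add: mono_sign_eq)
qed

text \<open>The map of \<open>\<Lambda>V\<close>-modules determined by the images \<open>F c\<close> of the monomials \<open>c\<close> in the
  suspended generators, which form a basis of the acyclic closure over \<open>\<Lambda>V\<close>.\<close>

definition cell_ext ::
  "('v::linorder \<Rightarrow> nat) \<Rightarrow> ((bool \<times> 'v) multiset \<Rightarrow> 'v lam \<Rightarrow> 'v lam) \<Rightarrow> (bool \<times> 'v) lam \<Rightarrow> 'v lam \<Rightarrow> 'v lam" where
  "cell_ext dg F p y = lext (\<lambda>M. lmult dg (Poly_Mapping.single (vpart M) 1) (F (cell M) y)) p"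

lemma cell_ext_lmult: "cell_ext dg F (lmult (cdg dg) (emb a) q) y = lmult dg a (cell_ext dg F q y)"
proof -
  have "a \<in> lspan UNIV" "q \<in> lspan UNIV" by (simp_all add: lspan_def)
  from this(1) show ?thesis
  proof (induction a rule: lspan_induct)
    case (single M c)
    from \<open>q \<in> lspan UNIV\<close> show ?case
    proof (induction q rule: lspan_induct)
      case (single N e)
      let ?\<theta> = "F (cell N) y"
      have s: "lmult dg (Poly_Mapping.single K a) ?\<theta> = lscale a (lmult dg (Poly_Mapping.single K 1) ?\<theta>)" for K a
        using lmult_lscale_left[of dg a "Poly_Mapping.single K 1" ?\<theta>] by simp
      show ?case
        using s[of "M + vpart N" "c * mono_sign dg M (vpart N)"]
        by (simp add: cell_ext_def lmult_single_single mono_sign_emb_left lmult_lscale_right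
            lmult_assoc[symmetric] mult_ac)
    qed (simp_all add: cell_ext_def lmult_add_right lext_add)
  qed (simp_all add: cell_ext_def lmult_add_left emb_add lext_add)
qed

lemma cell_ext_zero [simp]: "cell_ext dg F 0 = 0"
  and cell_ext_add: "cell_ext dg F (p + q) = cell_ext dg F p + cell_ext dg F q"
  and cell_ext_lscale: "cell_ext dg F (lscale c p) = (\<lambda>y. lscale c (cell_ext dg F p y))"
  and cell_ext_ksign: "cell_ext dg F (ksign k p) y = ksign k (cell_ext dg F p y)"
  by (auto simp: cell_ext_def fun_eq_iff lext_add lext_lscale ksign_eq_lscale)

lemma cell_ext_single:
  "cell_ext dg F (Poly_Mapping.single M 1) = (\<lambda>y. lmult dg (Poly_Mapping.single (vpart M) 1) (F (cell M) y))"
  by (simp add: cell_ext_def fun_eq_iff)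

section \<open>Lifting cells to derivations by obstruction theory\<close>

context minimal_model
begin

lemma mdeg_ge_2:
  assumes "M \<in> lmonos B dg" "M \<noteq> {#}"
  shows "2 \<le> mdeg dg M"
  using assms dg_ge_2 by (cases M) (auto simp: lmonos_def trans_le_add1)

text \<open>Generators start in degree 2, so the algebra vanishes in degree 1 and in negative
  degrees.\<close>

lemma Lam_deg_trivial:
  assumes "p \<in> Lam_deg B dg k" "k < 2" "k \<noteq> 0"
  shows "p = 0"
proof -
  have "{M \<in> lmonos B dg. int (mdeg dg M) = k} = {}"
    using assms(2,3) mdeg_ge_2 by force
  then show ?thesis using assms(1) unfolding Lam_deg_eq_lspan by (simp only: lspan_empty) simp
qed

text \<open>A basis of the submodule generated over the minimal model by the cells of degree at most
  \<open>m\<close>. Only the cell is bounded, not its coefficient.\<close>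

definition low_cells :: "nat \<Rightarrow> (bool \<times> 'v) multiset set" where
  "low_cells m = {M \<in> lmonos (cB B) (cdg dg). mdeg (cdg dg) (cell M) \<le> m}"

text \<open>A chain map on the cells of degree at most \<open>m\<close>. The empty cell goes to
  degree \<open>n\<close>; cohomological degree in the closure counts down in derivation degree,
  whence \<open>int n - int (mdeg (cdg dg) c)\<close>.\<close>

definition partial_lift where
  "partial_lift D n F m \<longleftrightarrow> (\<forall>c\<in>low_cells m. cell c = c \<longrightarrow>
    F c \<in> Der B dg (int n - int (mdeg (cdg dg) c)) \<and>
    der_diff d (int n - int (mdeg (cdg dg) c)) (F c) = cell_ext dg F (D (Poly_Mapping.single c 1)))"

text \<open>The chain map property passes from cells to their multiples because \<open>D\<close> and
  \<open>der_diff\<close> satisfy the same Leibniz rule for multiplication by a coefficient.\<close>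

lemma partial_lift_ext:
  assumes "closure_diff k D" "partial_lift D n F m"
    and "p \<in> lspan {M \<in> low_cells m. int (mdeg (cdg dg) M) = e}"
  shows "cell_ext dg F p \<in> Der B dg (int n - e) \<and>
    der_diff d (int n - e) (cell_ext dg F p) = cell_ext dg F (D p)"
  using assms(3)
proof (induction p rule: lspan_induct)
  case (single M c)
  let ?W = "cB B" and ?g = "cdg dg"
  have D: "D \<in> Der ?W ?g (- 1)" and DF: "\<And>v. v \<in> B \<Longrightarrow> D (gen (False, v)) = emb (d (gen v))"
    using assms(1) by (auto simp: closure_diff_def)
  from single have M: "M \<in> lmonos ?W ?g" and le: "mdeg ?g (cell M) \<le> m" and e: "e = int (mdeg ?g M)"
    by (auto simp: low_cells_def)
  note Ms = lmonos_split[OF M]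
  let ?a = "Poly_Mapping.single (vpart M) (1 :: rat)" and ?c = "Poly_Mapping.single (cell M) (1 :: rat)"
  let ?k = "int n - int (mdeg ?g (cell M))" and ?l = "int (mdeg dg (vpart M))"
  have F: "F (cell M) \<in> Der B dg ?k"
    and dF: "der_diff d ?k (F (cell M)) = cell_ext dg F (D ?c)"
    using assms(2) Ms le by (auto simp: partial_lift_def low_cells_def)
  have a: "?a \<in> Lam_deg B dg ?l" by (rule single_in_Lam_deg[OF Ms(1)])
  have kl: "int n - e = ?k - ?l" by (simp add: e mdeg_split[of dg M])
  have split: "Poly_Mapping.single M 1 = lmult ?g (emb ?a) ?c"
    by (simp add: lmult_single_single mono_sign_emb_left emb_vpart_add_cell)
  have ext: "cell_ext dg F (Poly_Mapping.single M 1) = (\<lambda>y. lmult dg ?a (F (cell M) y))"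
    by (rule cell_ext_single)
  have 1: "cell_ext dg F (Poly_Mapping.single M 1) \<in> Der B dg (int n - e)"
    unfolding ext kl by (rule lmult_Der_in_Der[OF F a])
  have DM: "D (Poly_Mapping.single M 1) = lmult ?g (emb (d ?a)) ?c + ksign ?l (lmult ?g (emb ?a) (D ?c))"
  proof -
    have "D (emb ?a) = emb (d ?a)" by (rule Der_emb[OF D d_Der DF Lam_deg_subset_Lam[OF a]])
    moreover have "ksign (- 1 * ?l) q = ksign ?l q" for q :: "(bool \<times> 'v) lam"
      by (simp add: ksign_def)
    ultimately show ?thesis
      using Der_leibniz[OF D emb_in_Lam_deg[OF a] single_in_Lam[OF Ms(2)], of 1] by (simp only: split)
  qed
  have 2: "der_diff d (int n - e) (cell_ext dg F (Poly_Mapping.single M 1)) =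
      cell_ext dg F (D (Poly_Mapping.single M 1))"
  proof
    fix y
    have "cell_ext dg F ?c y = F (cell M) y" by (simp add: cell_ext_single)
    then show "der_diff d (int n - e) (cell_ext dg F (Poly_Mapping.single M 1)) y =
        cell_ext dg F (D (Poly_Mapping.single M 1)) y"
      unfolding DM cell_ext_add plus_fun_apply cell_ext_ksign cell_ext_lmult ext kl
        der_diff_lmult[OF d_Der F a] dF by simp
  qed
  have sc: "Poly_Mapping.single M c = lscale c (Poly_Mapping.single M 1)" by simp
  show ?case
    unfolding sc cell_ext_lscale Der_lscale[OF D single_in_Lam[OF M]]
    using Der_lscale_in_Der[OF 1] der_diff_lscale[OF d_Der 1] 2 by simp
next
  case zero
  have "D 0 = 0" using assms(1) Der_zero by (auto simp: closure_diff_def)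
  then show ?case
    by (simp only: cell_ext_zero Der_zero_in_Der der_diff_zero[OF d_Der] simp_thms)
next
  case (add p q)
  have "p \<in> Lam (cB B) (cdg dg)" "q \<in> Lam (cB B) (cdg dg)"
    using add.hyps by (auto simp: lspan_def Lam_def low_cells_def)
  moreover have "D \<in> Der (cB B) (cdg dg) (- 1)" using assms(1) by (simp add: closure_diff_def)
  ultimately have "D (p + q) = D p + D q" by (simp add: Der_add)
  moreover have "cell_ext dg F p + cell_ext dg F q \<in> Der B dg (int n - e)"
    using add.IH by (intro Der_add_in_Der) auto
  moreover have "der_diff d (int n - e) (cell_ext dg F p + cell_ext dg F q) =
      cell_ext dg F (D p) + cell_ext dg F (D q)"
    using add.IH by (metis der_diff_add[OF d_Der])
  ultimately show ?case
    by (simp only: cell_ext_add simp_thms)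
qed

text \<open>A new cell of degree \<open>m + 1\<close> has the obstruction
  \<open>cell_ext dg F (D c)\<close>. It is a cycle of degree n - m - 2, which lies between 1 and n
  - 2, so exactness provides the value on the cell.\<close>

lemma partial_lift_exists:
  assumes D: "closure_diff n D" and top: "\<And>v. v \<in> B \<Longrightarrow> dg v \<le> n"
    and \<psi>: "\<psi> \<in> Der B dg (int n)" "der_diff d (int n) \<psi> = 0"
    and exact: "\<And>k \<theta>. 1 \<le> k \<Longrightarrow> k \<le> int n - 2 \<Longrightarrow> \<theta> \<in> Der B dg k \<Longrightarrow> der_diff d k \<theta> = 0 \<Longrightarrow>
      \<exists>\<zeta>\<in>Der B dg (k + 1). der_diff d (k + 1) \<zeta> = \<theta>"
  shows "m + 2 \<le> n \<Longrightarrow> \<exists>F. F {#} = \<psi> \<and> partial_lift D n F m"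
proof (induction m)
  case 0
  \<comment> \<open>Every suspension has positive degree, so the only cell of degree 0 is the empty
    one.\<close>
  have "c = {#}" if "c \<in> low_cells 0" "cell c = c" for c
    using that size_le_mdeg[of c] by (auto simp: low_cells_def)
  moreover have "D 1 = 0" using D Der_one by (auto simp: closure_diff_def)
  ultimately have "partial_lift D n (\<lambda>_. \<psi>) 0"
    using \<psi> by (fastforce simp: partial_lift_def)
  then show ?case by (intro exI[of _ "\<lambda>_. \<psi>"]) simp
next
  case (Suc m)
  let ?W = "cB B" and ?g = "cdg dg"
  have DD: "D \<in> Der ?W ?g (- 1)" using D by (simp add: closure_diff_def)
  from Suc obtain F where F: "F {#} = \<psi>" "partial_lift D n F m" by auto
  define C where "C = {c \<in> low_cells (Suc m). cell c = c \<and> mdeg ?g c = Suc m}"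
  \<comment> \<open>\<open>D\<close> raises degree by 1, but each term has unsuspended factors of
    total degree at least 2. The degree of the cell therefore drops.\<close>
  have D_low: "D (Poly_Mapping.single c 1) \<in> lspan {M \<in> low_cells m. int (mdeg ?g M) = int (mdeg ?g c) + 1}"
    if c: "c \<in> lmonos ?W ?g" "mdeg ?g c \<le> Suc m" for c
  proof -
    have 1: "D (Poly_Mapping.single c 1) \<in> Lam_deg ?W ?g (int (mdeg ?g c) + 1)"
      using Der_deg[OF DD single_in_Lam_deg[OF c(1)]] by (simp add: add.commute)
    have "Poly_Mapping.single c 1 \<in> FilV B dg 0"
      by (rule single_in_Fil[OF c(1)]) (simp add: weight_V_eq)
    from closure_diff_FilV[OF D this] have 2: "D (Poly_Mapping.single c 1) \<in> FilV B dg 1" by simp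
    have "M \<in> {M \<in> low_cells m. int (mdeg ?g M) = int (mdeg ?g c) + 1}"
      if "M \<in> Poly_Mapping.keys (D (Poly_Mapping.single c 1))" for M
    proof -
      have M: "M \<in> lmonos ?W ?g" "int (mdeg ?g M) = int (mdeg ?g c) + 1"
        using 1 that by (auto simp: Lam_deg_def Lam_def)
      have "1 \<le> int (size (vpart M))"
        using 2 that by (auto simp: Fil_def lspan_def weight_V_eq)
      then have "vpart M \<noteq> {#}" by auto
      with mdeg_ge_2[OF lmonos_split(1)[OF M(1)]] mdeg_split[of dg M] M c(2) show ?thesis
        by (simp add: low_cells_def)
    qed
    then show ?thesis unfolding lspan_def by blast
  qed
  \<comment> \<open>No generator has degree above \<open>n\<close>, so stage \<open>n\<close> of the
    closure has a genuine differential.\<close>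
  have D2: "D (D p) = 0" if "p \<in> Lam ?W ?g" for p
    by (rule closure_diff_square[OF D that top])
  have "\<exists>\<zeta>. \<zeta> \<in> Der B dg (int n - int (Suc m)) \<and>
      der_diff d (int n - int (Suc m)) \<zeta> = cell_ext dg F (D (Poly_Mapping.single c 1))" if "c \<in> C" for c
  proof -
    have c: "c \<in> lmonos ?W ?g" "mdeg ?g c = Suc m" using that by (auto simp: C_def low_cells_def)
    have "D (Poly_Mapping.single c 1) \<in> lspan {M \<in> low_cells m. int (mdeg ?g M) = int (Suc m) + 1}"
      using D_low[OF c(1)] c(2) by simp
    \<comment> \<open>The obstruction is closed: its differential is
      \<open>cell_ext dg F (D (D c))\<close>.\<close>
    from partial_lift_ext[OF D F(2) this]
    have "cell_ext dg F (D (Poly_Mapping.single c 1)) \<in> Der B dg (int n - int (Suc m) - 1)"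
      "der_diff d (int n - int (Suc m) - 1) (cell_ext dg F (D (Poly_Mapping.single c 1))) = 0"
      using D2[OF single_in_Lam[OF c(1)]] by (simp_all add: diff_diff_eq)
    from exact[OF _ _ this] Suc.prems
    have "\<exists>\<zeta>\<in>Der B dg (int n - int (Suc m) - 1 + 1).
        der_diff d (int n - int (Suc m) - 1 + 1) \<zeta> = cell_ext dg F (D (Poly_Mapping.single c 1))"
      by simp
    then show ?thesis
      unfolding diff_add_cancel by blast
  qed
  then obtain Z where Z: "\<And>c. c \<in> C \<Longrightarrow> Z c \<in> Der B dg (int n - int (Suc m))"
    "\<And>c. c \<in> C \<Longrightarrow> der_diff d (int n - int (Suc m)) (Z c) = cell_ext dg F (D (Poly_Mapping.single c 1))"
    by metis
  define F' where "F' c = (if c \<in> C then Z c else F c)" for c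
  \<comment> \<open>The new values sit on cells of degree \<open>Suc m\<close> only, so the
    extension is unchanged on everything that \<open>D\<close> of such a cell can involve.\<close>
  have ext: "cell_ext dg F' p = cell_ext dg F p" if "p \<in> lspan (low_cells m)" for p
  proof
    fix y show "cell_ext dg F' p y = cell_ext dg F p y"
      unfolding cell_ext_def
    proof (rule lext_cong)
      fix M assume "M \<in> Poly_Mapping.keys p"
      then have "mdeg ?g (cell M) \<le> m" using that by (auto simp: lspan_def low_cells_def)
      then have "cell M \<notin> C" by (simp add: C_def)
      then show "lmult dg (Poly_Mapping.single (vpart M) 1) (F' (cell M) y) =
          lmult dg (Poly_Mapping.single (vpart M) 1) (F (cell M) y)" by (simp add: F'_def)
    qed
  qed
  have "partial_lift D n F' (Suc m)"
    unfolding partial_lift_def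
  proof (intro ballI impI)
    fix c assume c: "c \<in> low_cells (Suc m)" "cell c = c"
    then have "c \<in> lmonos ?W ?g" "mdeg ?g c \<le> Suc m" by (simp_all add: low_cells_def)
    from D_low[OF this] have low: "D (Poly_Mapping.single c 1) \<in> lspan (low_cells m)"
      unfolding lspan_def by blast
    show "F' c \<in> Der B dg (int n - int (mdeg ?g c)) \<and>
        der_diff d (int n - int (mdeg ?g c)) (F' c) = cell_ext dg F' (D (Poly_Mapping.single c 1))"
    proof (cases "mdeg ?g c = Suc m")
      case True
      then have "c \<in> C" using c by (simp add: C_def)
      then show ?thesis using Z True by (simp add: F'_def ext[OF low])
    next
      case False
      then have "c \<in> low_cells m" "c \<notin> C" using c by (simp_all add: low_cells_def C_def)
      then show ?thesis
        using F(2) c(2) by (simp add: F'_def ext[OF low] partial_lift_def)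
    qed
  qed
  moreover have "F' {#} = \<psi>" by (simp add: F'_def C_def F(1))
  ultimately show ?case by blast
qed

end

section \<open>The contradiction\<close>

lemma Der_eq_zeroI:
  assumes "\<theta> \<in> Der B dg k" "\<And>x. x \<in> B \<Longrightarrow> \<theta> (gen x) = 0"
  shows "\<theta> = 0"
proof (rule Der_ext[OF assms(1) Der_zero_in_Der])
  fix p assume p: "p \<in> Lam B dg"
  show "\<theta> p = 0 p"
    unfolding zero_fun_apply
  proof (rule Der_eq_0[OF assms(1) p])
    fix M x assume "M \<in> Poly_Mapping.keys p" "x \<in># M"
    with p show "\<theta> (gen x) = 0" by (intro assms(2)) (auto simp: Lam_def lmonos_def)
  qed
qed

context minimal_model
begin

lemma Der_above_top:
  assumes "\<And>v. v \<in> B \<Longrightarrow> dg v \<le> n" "int n < k" "\<theta> \<in> Der B dg k"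
  shows "\<theta> = 0"
proof (rule Der_eq_zeroI[OF assms(3)])
  fix x assume x: "x \<in> B"
  show "\<theta> (gen x) = 0"
    using Der_deg[OF assms(3) gen_in_Lam_deg[OF x]] assms(1)[OF x] assms(2)
    by (intro Lam_deg_trivial[where k = "int (dg x) - k"]) auto
qed

text \<open>The partial derivative along \<open>v0\<close> kills \<open>d (gen x)\<close>: a
  decomposable of degree \<open>dg x + 1\<close> involves only generators of degree below
  \<open>dg x\<close>, hence not \<open>v0\<close>. Its values on generators are constants, which
  \<open>d\<close> kills.\<close>

lemma top_cycle:
  assumes top: "\<And>v. v \<in> B \<Longrightarrow> dg v \<le> n" and v0: "v0 \<in> B" "dg v0 = n"
  obtains \<psi> where "\<psi> \<in> Der B dg (int n)" "der_diff d (int n) \<psi> = 0" "\<psi> (gen v0) = 1"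
proof -
  have "(if x = v0 then 1 else 0 :: 'v lam) \<in> Lam_deg B dg (int (dg x) - int n)" if "x \<in> B" for x
    using single_in_Lam_deg[of "{#}" B dg 1] v0 by auto
  then obtain \<psi> where \<psi>: "\<psi> \<in> Der B dg (int n)" "\<And>x. x \<in> B \<Longrightarrow> \<psi> (gen x) = (if x = v0 then 1 else 0)"
    using Der_exists[of B "\<lambda>x. if x = v0 then 1 else 0" dg "int n"] by metis
  have "der_diff d (int n) \<psi> (gen x) = 0" if x: "x \<in> B" for x
  proof -
    have "\<psi> (d (gen x)) = 0"
    proof (rule Der_eq_0[OF \<psi>(1) Der_Lam[OF d_Der gen_in_Lam[OF x]]])
      fix M y assume M: "M \<in> Poly_Mapping.keys (d (gen x))" "y \<in># M"
      have MB: "M \<in> lmonos B dg" "2 \<le> size M" "mdeg dg M = dg x + 1"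
        using M(1) d_decomposable[OF x] Der_deg[OF d_Der gen_in_Lam_deg[OF x]]
        by (auto simp: Lam_decomposable_def Lam_deg_def Lam_def)
      obtain M' where M': "M = add_mset y M'" using M(2) by (metis insert_DiffM)
      with MB have "M' \<in> lmonos B dg" "M' \<noteq> {#}" using lmonos_add_mset(2)[of y M'] by auto
      from mdeg_ge_2[OF this] have "dg y < dg x" using MB(3) M' by simp
      moreover have "y \<in> B" using MB(1) M(2) by (auto simp: lmonos_def)
      ultimately show "\<psi> (gen y) = 0" using \<psi>(2)[of y] top[OF x] v0(2) by auto
    qed
    moreover have "d (\<psi> (gen x)) = 0"
      using \<psi>(2)[OF x] Der_one[OF d_Der] Der_zero[OF d_Der] by simp
    ultimately show ?thesis by (simp add: der_diff_apply ksign_def)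
  qed
  then have "der_diff d (int n) \<psi> = 0"
    by (rule Der_eq_zeroI[OF der_diff_in_Der[OF d_Der \<psi>(1)]])
  then show thesis using that \<psi> v0(1) by simp
qed

lemma adjacent_cycles_contradiction:
  assumes top: "\<And>v. v \<in> B \<Longrightarrow> dg v \<le> n" and v0: "v0 \<in> B" "dg v0 = n"
    and \<phi>: "\<phi> \<in> Der B dg (int n - 1)" "der_diff d (int n - 1) \<phi> = 0" "\<phi> \<noteq> 0"
    and exact: "\<And>k \<theta>. 1 \<le> k \<Longrightarrow> k \<le> int n - 2 \<Longrightarrow> \<theta> \<in> Der B dg k \<Longrightarrow> der_diff d k \<theta> = 0 \<Longrightarrow>
      \<exists>\<zeta>\<in>Der B dg (k + 1). der_diff d (k + 1) \<zeta> = \<theta>"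
  shows False
proof -
  let ?W = "cB B" and ?g = "cdg dg"
  \<comment> \<open>The value has degree at most 1, and the algebra is nonzero there only in degree
    0, that is, for \<open>dg y = n - 1\<close>.\<close>
  have \<phi>_gen: "\<phi> (gen y) = 0" if "y \<in> B" "dg y \<noteq> n - 1" for y
    using Der_deg[OF \<phi>(1) gen_in_Lam_deg[OF that(1)]] top[OF that(1)] that(2) dg_ge_2[OF that(1)]
    by (intro Lam_deg_trivial[where k = "int (dg y) - (int n - 1)"]) auto
  have "\<exists>x\<in>B. \<phi> (gen x) \<noteq> 0"
  proof (rule ccontr)
    assume "\<not> (\<exists>x\<in>B. \<phi> (gen x) \<noteq> 0)"
    then have "\<phi> = 0" by (intro Der_eq_zeroI[OF \<phi>(1)]) blast
    with \<phi>(3) show False by simp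
  qed
  then obtain x where x: "x \<in> B" "\<phi> (gen x) \<noteq> 0" by blast
  have dgx: "dg x = n - 1" using \<phi>_gen[OF x(1)] x(2) by blast
  have n3: "3 \<le> n" using dg_ge_2[OF x(1)] dgx by simp
  \<comment> \<open>A decomposable of degree n - 1 involves only generators of smaller degree, all
    of which \<phi> kills.\<close>
  have \<phi>_dec: "\<phi> p = 0" if p: "p \<in> Lam_deg B dg (int n - 1)" "p \<in> Lam_decomposable B dg" for p
  proof (rule Der_eq_0[OF \<phi>(1) Lam_deg_subset_Lam[OF p(1)]])
    fix M y assume M: "M \<in> Poly_Mapping.keys p" "y \<in># M"
    have MB: "M \<in> lmonos B dg" "2 \<le> size M" "mdeg dg M = n - 1"
      using M(1) p n3 by (auto simp: Lam_decomposable_def Lam_deg_def Lam_def)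
    obtain M' where M': "M = add_mset y M'" using M(2) by (metis insert_DiffM)
    with MB have "M' \<in> lmonos B dg" "M' \<noteq> {#}" using lmonos_add_mset(2)[of y M'] by auto
    from mdeg_ge_2[OF this] have "dg y \<noteq> n - 1" using MB(3) M' by simp
    moreover have "y \<in> B" using MB(1) M(2) by (auto simp: lmonos_def)
    ultimately show "\<phi> (gen y) = 0" by (intro \<phi>_gen)
  qed
  have \<phi>_d: "\<phi> (d q) = ksign (int n - 1) (d (\<phi> q))" for q
  proof -
    have "d (\<phi> q) - ksign (int n - 1) (\<phi> (d q)) = 0"
      using fun_cong[OF \<phi>(2), of q] by (simp add: der_diff_apply)
    then show ?thesis by (auto simp: ksign_def)
  qed
  obtain \<psi> where \<psi>: "\<psi> \<in> Der B dg (int n)" "der_diff d (int n) \<psi> = 0" "\<psi> (gen v0) = 1"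
    using top_cycle[OF top v0] .
  obtain D where D: "closure_diff n D" using closure_diff_exists by blast
  have DD: "D \<in> Der ?W ?g (- 1)" using D by (simp add: closure_diff_def)
  have "\<exists>F. F {#} = \<psi> \<and> partial_lift D n F (n - 2)"
  proof (rule partial_lift_exists[OF D _ \<psi>(1,2)])
    show "dg v \<le> n" if "v \<in> B" for v by (rule top[OF that])
    show "\<exists>\<zeta>\<in>Der B dg (k + 1). der_diff d (k + 1) \<zeta> = \<theta>"
      if "1 \<le> k" "k \<le> int n - 2" "\<theta> \<in> Der B dg k" "der_diff d k \<theta> = 0" for k \<theta>
      by (rule exact[OF that])
    show "n - 2 + 2 \<le> n" using n3 by simp
  qed
  then obtain F where F: "F {#} = \<psi>" "partial_lift D n F (n - 2)" by blast
  have F_Der: "F c \<in> Der B dg (int n - int (mdeg ?g c))" if "c \<in> low_cells (n - 2)" "cell c = c" for c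
    using F(2) that by (simp add: partial_lift_def)
  let ?x = "{#(True, x)#}" and ?z = "D (gen (True, x))"
  \<comment> \<open>The suspension of \<open>x\<close> has degree n - 2, exactly the bound of the
    lift; its image has degree 2.\<close>
  have xc: "?x \<in> low_cells (n - 2)" "cell ?x = ?x"
    using x(1) dgx by (simp_all add: low_cells_def cell_def)
  have k2: "int n - int (mdeg ?g ?x) = 2" using dgx n3 by simp
  have \<zeta>: "F ?x \<in> Der B dg 2" "der_diff d 2 (F ?x) = cell_ext dg F ?z"
    using F(2) xc k2 unfolding partial_lift_def gen_def by metis+
  define w where "w = ?z - gen (False, x)"
  have w: "w \<in> FilV B dg 1" "w \<in> FilS B dg 2"
    using D x(1) by (auto simp: closure_diff_def w_def)
  have z_deg: "?z \<in> Lam_deg ?W ?g (int n - 1)"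
    using Der_deg[OF DD gen_in_Lam_deg[of "(True, x)"]] x(1) dgx n3 by (simp add: of_nat_diff)
  have w_deg: "w \<in> Lam_deg ?W ?g (int n - 1)"
    unfolding w_def using gen_in_Lam_deg[of "(False, x)" ?W ?g] x(1) dgx n3
    by (intro Lam_deg_diff z_deg) (simp add: of_nat_diff)
  have ext_gen: "cell_ext dg F (gen (False, x)) (gen v0) = gen x"
    using cell_ext_single[of dg F "{#(False, x)#}"] \<psi>(3) by (simp add: F(1) gen_def)
  \<comment> \<open>There are two sources of decomposability. If the cell is empty, \<psi>
    contributes 1 and the coefficient already has length at least 2. Otherwise the value at
    \<open>gen v0\<close> has the positive degree of the cell, so it supplies a second factor
    besides the coefficient.\<close>
  have summand: "lmult dg (Poly_Mapping.single (vpart M) 1) (F (cell M) (gen v0)) \<in>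
      Lam_deg B dg (int n - 1) \<inter> Lam_decomposable B dg" if "M \<in> Poly_Mapping.keys w" for M
  proof -
    have M: "M \<in> lmonos ?W ?g" "int (mdeg ?g M) = int n - 1" "2 \<le> size M" "1 \<le> int (size (vpart M))"
      using that w w_deg by (auto simp: Lam_deg_def Lam_def Fil_def lspan_def weight_V_eq weight_const)
    note Ms = lmonos_split[OF M(1)]
    have "vpart M \<noteq> {#}" using M(4) by auto
    note ge = mdeg_ge_2[OF Ms(1) this]
    have low: "cell M \<in> low_cells (n - 2)"
      using Ms(2) M(2) ge mdeg_split[of dg M] by (simp add: low_cells_def)
    have val: "F (cell M) (gen v0) \<in> Lam_deg B dg (int (mdeg ?g (cell M)))"
      using Der_deg[OF F_Der[OF low cell_cell] gen_in_Lam_deg[OF v0(1)]] v0(2) by simp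
    have vp: "Poly_Mapping.single (vpart M) 1 \<in> Lam_deg B dg (int (mdeg dg (vpart M)))"
      by (rule single_in_Lam_deg[OF Ms(1)])
    have "lmult dg (Poly_Mapping.single (vpart M) 1) (F (cell M) (gen v0)) \<in> Lam_deg B dg (int n - 1)"
      using lmult_in_Lam_deg[OF vp val] M(2) mdeg_split[of dg M] by simp
    moreover have "lmult dg (Poly_Mapping.single (vpart M) 1) (F (cell M) (gen v0)) \<in> Lam_decomposable B dg"
    proof (cases "cell M = {#}")
      case True
      then have "2 \<le> size (vpart M)" using M(3) emb_vpart_add_cell[of M] by (metis add.right_neutral size_image_mset)
      then show ?thesis
        using Ms(1) by (simp add: True F(1) \<psi>(3) Lam_decomposable_eq_lspan single_in_lspan)
    next
      case False
      then have pos: "0 < mdeg ?g (cell M)"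
        using size_le_mdeg[OF Ms(2)] by (metis gr_zeroI le_zero_eq size_eq_0_iff_empty)
      have vp': "Poly_Mapping.single (vpart M) 1 \<in> lspan {N \<in> lmonos B dg. 1 \<le> size N}"
        using Ms(1) M(4) by (intro single_in_lspan) auto
      have val': "F (cell M) (gen v0) \<in> lspan {N \<in> lmonos B dg. 1 \<le> size N}"
      proof -
        have "1 \<le> size N" if "mdeg dg N = mdeg ?g (cell M)" for N
          using that pos by (cases N) auto
        then show ?thesis
          using val by (auto simp: Lam_deg_eq_lspan lspan_def)
      qed
      show ?thesis
        unfolding Lam_decomposable_eq_lspan
        by (rule lmult_in_lspan[OF vp' val']) (auto simp: add_in_lmonos_iff)
    qed
    ultimately show ?thesis by blast
  qed
  have ext_w: "cell_ext dg F w (gen v0) \<in> Lam_deg B dg (int n - 1)"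
    "cell_ext dg F w (gen v0) \<in> Lam_decomposable B dg"
    using summand unfolding cell_ext_def Lam_deg_eq_lspan Lam_decomposable_eq_lspan
    by (auto intro!: lext_in_lspan)
  have z: "?z = gen (False, x) + w" by (simp add: w_def)
  have "\<phi> (cell_ext dg F ?z (gen v0)) = \<phi> (gen x + cell_ext dg F w (gen v0))"
    unfolding z cell_ext_add plus_fun_apply ext_gen ..
  also have "\<dots> = \<phi> (gen x) + \<phi> (cell_ext dg F w (gen v0))"
    by (rule Der_add[OF \<phi>(1) gen_in_Lam[OF x(1)] Lam_deg_subset_Lam[OF ext_w(1)]])
  also have "\<dots> = \<phi> (gen x)" using \<phi>_dec[OF ext_w] by simp
  finally have nz: "\<phi> (cell_ext dg F ?z (gen v0)) \<noteq> 0" using x(2) by simp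
  have v0L: "gen v0 \<in> Lam B dg" by (rule gen_in_Lam[OF v0(1)])
  have dv0: "d (gen v0) \<in> Lam B dg" by (rule Der_Lam[OF d_Der v0L])
  have "cell_ext dg F ?z (gen v0) = d (F ?x (gen v0)) - F ?x (d (gen v0))"
    unfolding \<zeta>(2)[symmetric] by (simp add: der_diff_apply ksign_def)
  also have "\<phi> \<dots> = \<phi> (d (F ?x (gen v0))) - \<phi> (F ?x (d (gen v0)))"
    by (intro Der_diff[OF \<phi>(1)] Der_Lam[OF d_Der] Der_Lam[OF \<zeta>(1)] v0L)
  also have "\<phi> (d (F ?x (gen v0))) = 0"
  proof -
    \<comment> \<open>Applying \<phi> lands in degree (n - 2) - (n - 1) = -1.\<close>
    have "F ?x (gen v0) \<in> Lam_deg B dg (int n - 2)"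
      using Der_deg[OF \<zeta>(1) gen_in_Lam_deg[OF v0(1)]] v0(2) by simp
    from Der_deg[OF \<phi>(1) this] have "\<phi> (F ?x (gen v0)) = 0"
      by (intro Lam_deg_trivial[where k = "int n - 2 - (int n - 1)"]) auto
    then show ?thesis using \<phi>_d Der_zero[OF d_Der] by (simp add: ksign_def)
  qed
  also have "\<phi> (F ?x (d (gen v0))) = 0"
  proof -
    \<comment> \<open>The commutator lowers degree by n + 1, more than any generator has. So \<phi>
      can be moved next to \<open>d (gen v0)\<close>, and then past \<open>d\<close> onto
      \<open>gen v0\<close>, whose image has degree 1 and vanishes.\<close>
    have "(\<phi> \<circ> F ?x) - ksign ((int n - 1) * 2) (F ?x \<circ> \<phi>) = 0"
      by (rule Der_above_top[OF top _ Der_bracket[OF \<phi>(1) \<zeta>(1)]]) simp_all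
    from fun_cong[OF this, of "d (gen v0)"]
    have "\<phi> (F ?x (d (gen v0))) = F ?x (\<phi> (d (gen v0)))" by (simp add: ksign_def)
    also have "\<phi> (gen v0) = 0" using \<phi>_gen[OF v0(1)] v0(2) n3 by simp
    then have "\<phi> (d (gen v0)) = 0" using \<phi>_d Der_zero[OF d_Der] by (simp add: ksign_def)
    finally show ?thesis by (simp add: Der_zero[OF \<zeta>(1)])
  qed
  finally show False using nz by simp
qed

end

section \<open>Invariance of homology\<close>

text \<open>Vanishing homology is phrased as having exactly one class, so any bijection on homology
  transports it in both directions.\<close>

definition acyclic_at :: "'a::ab_group_add dgl_data \<Rightarrow> int \<Rightarrow> bool" where
  "acyclic_at L k \<longleftrightarrow> (\<exists>C. homology L k = {C})"

lemma bij_betw_singleton_iff: "bij_betw f A B \<Longrightarrow> (\<exists>a. A = {a}) \<longleftrightarrow> (\<exists>b. B = {b})"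
  by (metis bij_betw_same_card card_1_singletonE is_singletonI is_singleton_altdef)

lemma quasi_iso_step_acyclic_at:
  assumes "quasi_iso_step L M"
  shows "acyclic_at L k \<longleftrightarrow> acyclic_at M k"
proof -
  have *: "acyclic_at L k \<longleftrightarrow> acyclic_at M k" if "quasi_iso L M f"
    for L :: "'x::ab_group_add dgl_data" and M :: "'y::ab_group_add dgl_data" and f
    using that unfolding quasi_iso_def acyclic_at_def by (metis bij_betw_singleton_iff)
  show ?thesis
    using assms *[of L M] *[of M L] unfolding quasi_iso_step_def by blast
qed

lemma quasi_isomorphic_acyclic_at:
  assumes "quasi_isomorphic TYPE('c::ab_group_add) L M"
  shows "acyclic_at L k \<longleftrightarrow> acyclic_at M k"
proof -
  from assms obtain P Q :: "'c dgl_data" where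
    PQ: "quasi_iso_step L P" "quasi_iso_step\<^sup>*\<^sup>* P Q" "quasi_iso_step Q M"
    unfolding quasi_isomorphic_def by blast
  from PQ(2) have "acyclic_at P k \<longleftrightarrow> acyclic_at Q k"
    by (induction rule: rtranclp_induct) (simp_all add: quasi_iso_step_acyclic_at)
  then show ?thesis
    using quasi_iso_step_acyclic_at[OF PQ(1)] quasi_iso_step_acyclic_at[OF PQ(3)] by simp
qed

text \<open>The differential is zero, so homology is the graded space itself, with the two factors
  in the adjacent degrees n - 1 and n.\<close>

lemma acyclic_at_em_prod:
  assumes "1 \<le> s" "1 \<le> t"
  shows "acyclic_at (dgl_prod (em_dgl s n) (em_dgl t (n + 1))) k \<longleftrightarrow> k \<noteq> int n - 1 \<and> k \<noteq> int n"
proof -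
  let ?L = "dgl_prod (em_dgl s n) (em_dgl t (n + 1))"
  have 0: "dff ?L k = (\<lambda>v. 0)" for k
    by (simp add: dgl_prod_def em_dgl_def zero_prod_def fun_eq_iff)
  have z: "(0, 0) \<in> gr ?L k" for k
    by (simp add: dgl_prod_def em_dgl_def)
  have "boundaries ?L k = {0}"
    unfolding boundaries_def 0 using z[of "k + 1"] by auto
  then have "hclass ?L k x = {x}" for x
    unfolding hclass_def by (simp del: split_paired_Ex)
  then have "homology ?L k = (\<lambda>x. {x}) ` gr ?L k"
    unfolding homology_def cycles_def 0 by simp
  then have "acyclic_at ?L k \<longleftrightarrow> is_singleton ((\<lambda>x. {x}) ` gr ?L k)"
    unfolding acyclic_at_def is_singleton_def by simp
  also have "\<dots> \<longleftrightarrow> is_singleton (gr ?L k)"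
    by (simp add: is_singleton_altdef card_image)
  also have "\<dots> \<longleftrightarrow> gr ?L k = {(0, 0)}"
    using z[of k] unfolding is_singleton_def by (metis singletonD)
  finally have *: "acyclic_at ?L k \<longleftrightarrow> gr ?L k = {(0, 0)}" .
  \<comment> \<open>The first unit vector, which lies in both spaces because \<open>s\<close> and
    \<open>t\<close> are positive.\<close>
  let ?e = "\<lambda>i::nat. if i = 0 then 1 else 0 :: rat"
  have e: "?e \<noteq> 0" by (simp add: fun_eq_iff)
  have "gr ?L k \<noteq> {(0, 0)}" if "k = int n - 1"
  proof -
    have "(?e, 0) \<in> gr ?L k" using that assms by (simp add: dgl_prod_def em_dgl_def)
    then show ?thesis using e by force
  qed
  moreover have "gr ?L k \<noteq> {(0, 0)}" if "k = int n"
  proof -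
    have "(0, ?e) \<in> gr ?L k" using that assms by (simp add: dgl_prod_def em_dgl_def)
    then show ?thesis using e by force
  qed
  moreover have "gr ?L k = {(0, 0)}" if "k \<noteq> int n - 1" "k \<noteq> int n"
    using that by (auto simp: dgl_prod_def em_dgl_def)
  ultimately show ?thesis
    unfolding * by blast
qed

section \<open>Homology of the derivations and the top degree of V\<close>

context minimal_model
begin

lemma zero_in_cycles: "0 \<in> cycles (der_dgl B dg d) k"
  by (simp add: cycles_def der_dgl_def der_diff_zero[OF d_Der])

lemma zero_in_boundaries: "0 \<in> boundaries (der_dgl B dg d) k"
proof -
  have "0 \<in> gr (der_dgl B dg d) (k + 1)" using zero_in_cycles by (simp add: cycles_def)
  moreover have "dff (der_dgl B dg d) (k + 1) 0 = 0" by (simp add: der_dgl_def der_diff_zero[OF d_Der])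
  ultimately show ?thesis unfolding boundaries_def by (metis image_eqI)
qed

lemma acyclic_at_imp_boundary:
  assumes "acyclic_at (der_dgl B dg d) k" "\<theta> \<in> cycles (der_dgl B dg d) k"
  shows "\<theta> \<in> boundaries (der_dgl B dg d) k"
proof -
  let ?L = "der_dgl B dg d"
  have "hclass ?L k \<theta> = hclass ?L k 0"
    using assms zero_in_cycles[of k] unfolding acyclic_at_def homology_def by (metis image_eqI singletonD)
  moreover have "\<theta> \<in> hclass ?L k \<theta>"
    using zero_in_boundaries[of k] unfolding hclass_def by force
  ultimately show ?thesis by (auto simp: hclass_def)
qed

lemma not_acyclic_at_imp_cycle:
  assumes "\<not> acyclic_at (der_dgl B dg d) k"
  obtains \<theta> where "\<theta> \<in> cycles (der_dgl B dg d) k" "\<theta> \<noteq> 0"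
proof -
  have "cycles (der_dgl B dg d) k \<noteq> {0}"
    using assms unfolding acyclic_at_def homology_def by auto
  then show thesis using that zero_in_cycles[of k] by blast
qed

text \<open>In degree 1 the truncation keeps precisely the cycles, so it does not change the set of
  cycles.\<close>

lemma cycles_der_dgl:
  "1 \<le> k \<Longrightarrow> \<theta> \<in> cycles (der_dgl B dg d) k \<longleftrightarrow> \<theta> \<in> Der B dg k \<and> der_diff d k \<theta> = 0"
  by (auto simp: cycles_def der_dgl_def)

text \<open>Boundaries in positive degree come from degree at least 2, above the truncation.\<close>

lemma boundaries_der_dgl:
  "1 \<le> k \<Longrightarrow> boundaries (der_dgl B dg d) k = der_diff d (k + 1) ` Der B dg (k + 1)"
  by (simp add: boundaries_def der_dgl_def)

text \<open>Homology in degree \<open>n\<close> forces the top degree \<open>N\<close> to be at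
  least \<open>n\<close>. The partial derivative along a top generator survives in degree
  \<open>N\<close>, which forces \<open>N\<close> to be at most \<open>n\<close>.\<close>

lemma homology_not_two_adjacent:
  assumes "2 \<le> n" "pi_finite B dg"
    and acyclic: "\<And>k. acyclic_at (der_dgl B dg d) k \<longleftrightarrow> k \<noteq> int n - 1 \<and> k \<noteq> int n"
  shows False
proof -
  let ?L = "der_dgl B dg d"
  obtain \<phi> where "\<phi> \<in> cycles ?L (int n - 1)" "\<phi> \<noteq> 0"
    using acyclic not_acyclic_at_imp_cycle by metis
  then have \<phi>: "\<phi> \<in> Der B dg (int n - 1)" "der_diff d (int n - 1) \<phi> = 0" "\<phi> \<noteq> 0"
    using assms(1) by (simp_all add: cycles_der_dgl)
  obtain \<chi> where "\<chi> \<in> cycles ?L (int n)" "\<chi> \<noteq> 0"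
    using acyclic not_acyclic_at_imp_cycle by metis
  then have \<chi>: "\<chi> \<in> Der B dg (int n)" "\<chi> \<noteq> 0"
    using assms(1) by (simp_all add: cycles_der_dgl)
  have fin: "finite (dg ` B)" using assms(2) by (simp add: pi_finite_def)
  \<comment> \<open>Otherwise the nonzero \<chi> would lower degree by more than any generator
    has.\<close>
  have "\<not> (\<forall>v\<in>B. dg v < n)"
  proof
    assume "\<forall>v\<in>B. dg v < n"
    then have "\<chi> = 0" using assms(1) by (intro Der_above_top[OF _ _ \<chi>(1), of "n - 1"]) auto
    with \<chi>(2) show False by simp
  qed
  then obtain v where v: "v \<in> B" "n \<le> dg v" by (auto simp: not_less)
  define N where "N = Max (dg ` B)"
  have top: "dg u \<le> N" if "u \<in> B" for u using fin that by (simp add: N_def)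
  have "N \<in> dg ` B" unfolding N_def using fin v(1) by (intro Max_in) auto
  then obtain v0 where v0: "v0 \<in> B" "dg v0 = N" by auto
  obtain \<psi> where \<psi>: "\<psi> \<in> Der B dg (int N)" "der_diff d (int N) \<psi> = 0" "\<psi> (gen v0) = 1"
    using top_cycle[OF top v0] .
  have nN: "n \<le> N" using v top[OF v(1)] by simp
  \<comment> \<open>There are no nonzero derivations of degree \<open>N + 1\<close> to bound
    it.\<close>
  have "\<psi> \<notin> boundaries ?L (int N)"
  proof
    assume "\<psi> \<in> boundaries ?L (int N)"
    then obtain \<eta> where \<eta>: "\<eta> \<in> Der B dg (int N + 1)" "\<psi> = der_diff d (int N + 1) \<eta>"
      using nN assms(1) by (auto simp: boundaries_der_dgl)
    have "\<eta> = 0" by (rule Der_above_top[OF top _ \<eta>(1)]) simp_all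
    then have "\<psi> = 0" using \<eta>(2) der_diff_zero[OF d_Der] by simp
    with \<psi>(3) show False by simp
  qed
  moreover have "\<psi> \<in> cycles ?L (int N)" using \<psi> nN assms(1) by (simp add: cycles_der_dgl)
  ultimately have "\<not> acyclic_at ?L (int N)" using acyclic_at_imp_boundary by blast
  \<comment> \<open>Nonvanishing homology leaves \<open>n - 1\<close> and \<open>n\<close> for
    \<open>N\<close>, and \<open>nN\<close> excludes the first.\<close>
  then have N: "N = n" using acyclic nN by auto
  show False
  proof (rule adjacent_cycles_contradiction[OF top[unfolded N] v0[unfolded N] \<phi>])
    fix k \<theta> assume k: "1 \<le> k" "k \<le> int n - 2" and \<theta>: "\<theta> \<in> Der B dg k" "der_diff d k \<theta> = 0"
    have "acyclic_at ?L k" using k acyclic by auto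
    moreover have "\<theta> \<in> cycles ?L k" using \<theta> k by (simp add: cycles_der_dgl)
    ultimately have "\<theta> \<in> boundaries ?L k" by (rule acyclic_at_imp_boundary)
    then show "\<exists>\<zeta>\<in>Der B dg (k + 1). der_diff d (k + 1) \<zeta> = \<theta>"
      using k by (auto simp: boundaries_der_dgl)
  qed
qed

end

theorem theorem1p3:
  fixes n s t :: nat
  assumes "n \<ge> 2" and "s \<ge> 1" and "t \<ge> 1"
  shows "\<not> (\<exists>(B :: 'v::linorder set) dg d.
           sc_minimal_model B dg d \<and> pi_finite B dg \<and> cohomology_finite_type B dg d \<and>
           quasi_isomorphic TYPE('c::ab_group_add) (der_dgl B dg d)
             (dgl_prod (em_dgl s n) (em_dgl t (n + 1))))"
proof
  assume "\<exists>(B :: 'v set) dg d.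
           sc_minimal_model B dg d \<and> pi_finite B dg \<and> cohomology_finite_type B dg d \<and>
           quasi_isomorphic TYPE('c) (der_dgl B dg d) (dgl_prod (em_dgl s n) (em_dgl t (n + 1)))"
  then obtain B :: "'v set" and dg d where
    min: "sc_minimal_model B dg d" and fin: "pi_finite B dg" and
    qi: "quasi_isomorphic TYPE('c) (der_dgl B dg d) (dgl_prod (em_dgl s n) (em_dgl t (n + 1)))"
    by blast
  interpret minimal_model B dg d by unfold_locales (rule min)
  show False
    using homology_not_two_adjacent[OF assms(1) fin]
      quasi_isomorphic_acyclic_at[OF qi] acyclic_at_em_prod[OF assms(2,3)] by blast
qed

end
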